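(* Every finite poset $P$ whose cover graph has treewidth at most $2$ satisfies $\dim(P)\leq 1276$.
   Context: For a finite poset $P=(X,\leq)$, the cover graph of $P$ is the (undirected, simple) graph on $X$ in which two distinct elements $x,y$ are adjacent if and only if one covers the other, i.e. $x<y$ (or $y<x$) in $P$ and there is no $z$ with $x<z<y$ (resp. $y<z<x$). The dimension $\dim(P)$ is the least positive integer $d$ for which there are $d$ linear extensions $L_1,\dots,L_d$ of $P$ such that $x\leq y$ in $P$ if and only if $x\leq y$ in $L_i$ for every $i\in\{1,\dots,d\}$. The treewidth of a graph $G=(V,E)$ is the least $t$ such that there exist a tree $T$ and nonempty subtrees $T_x$ ($x\in V$) with $V(T_x)\cap V(T_y)\neq\emptyset$ for every edge $xy\in E$ and with at most $t+1$ vertices $x$ having $u\in V(T_x)$, for every node $u$ of $T$. *)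

theory Defs
  imports "Graph_Theory.Graph_Theory"
begin

(* A poset is given by its carrier X and its reflexive order relation r,
   with partial_order_on X r. *)

definition covers :: "'a rel \<Rightarrow> 'a \<Rightarrow> 'a \<Rightarrow> bool" where
  "covers r y x \<longleftrightarrow>
     (x, y) \<in> r \<and> x \<noteq> y \<and>
     \<not> (\<exists>z. (x, z) \<in> r \<and> x \<noteq> z \<and> (z, y) \<in> r \<and> z \<noteq> y)"

(* An undirected simple graph is a pair_graph: each edge xy is present as the two arcs
   (x, y) and (y, x). *)

definition cover_graph :: "'a set \<Rightarrow> 'a rel \<Rightarrow> 'a pair_pre_digraph" where
  "cover_graph X r =
     \<lparr> pverts = X, parcs = {(x, y). x \<in> X \<and> y \<in> X \<and> (covers r x y \<or> covers r y x)} \<rparr>"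

definition linear_extension :: "'a set \<Rightarrow> 'a rel \<Rightarrow> 'a rel \<Rightarrow> bool" where
  "linear_extension X r L \<longleftrightarrow> linear_order_on X L \<and> r \<subseteq> L"

(* Meant for finite posets, where a suitable d exists. *)

definition poset_dim :: "'a set \<Rightarrow> 'a rel \<Rightarrow> nat" where
  "poset_dim X r = (LEAST d. 0 < d \<and>
     (\<exists>L :: nat \<Rightarrow> 'a rel.
        (\<forall>i\<in>{1..d}. linear_extension X r (L i)) \<and>
        (\<forall>x\<in>X. \<forall>y\<in>X. (x, y) \<in> r \<longleftrightarrow> (\<forall>i\<in>{1..d}. (x, y) \<in> L i))))"

(* The library's predicate tree is not usable here: it only forbids directed cycles, so it
   rejects every symmetric digraph with an edge (because of the closed walk u, v, u) and
   accepts, for instance, a transitively oriented triangle.  In a pair_graph, the cycles of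
   length at least 3 are exactly the (oriented) cycles of the undirected graph.
   Connectedness includes that the graph has a vertex. *)

definition undirected_tree :: "'a pair_pre_digraph \<Rightarrow> bool" where
  "undirected_tree T \<longleftrightarrow>
     pair_graph T \<and> connected (with_proj T) \<and>
     \<not> (\<exists>p. pre_digraph.cycle (with_proj T) p \<and> 3 \<le> length p)"

definition subtree :: "'a pair_pre_digraph \<Rightarrow> 'a pair_pre_digraph \<Rightarrow> bool" where
  "subtree S T \<longleftrightarrow> subgraph (with_proj S) (with_proj T) \<and> undirected_tree S"

definition tree_decomposition ::
    "'a pair_pre_digraph \<Rightarrow> 'b pair_pre_digraph \<Rightarrow> ('a \<Rightarrow> 'b pair_pre_digraph) \<Rightarrow> bool" where
  "tree_decomposition G T S \<longleftrightarrow>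
     undirected_tree T \<and>
     (\<forall>x\<in>pverts G. subtree (S x) T) \<and>
     (\<forall>(x, y)\<in>parcs G. pverts (S x) \<inter> pverts (S y) \<noteq> {})"

(* Meant for finite graphs, where a suitable t exists.  As trees are finite, nat is no
   restriction on their nodes. *)

definition treewidth :: "'a pair_pre_digraph \<Rightarrow> nat" where
  "treewidth G = (LEAST t. \<exists>(T :: nat pair_pre_digraph) S.
     tree_decomposition G T S \<and>
     (\<forall>u\<in>pverts T. card {x \<in> pverts G. u \<in> pverts (S x)} \<le> t + 1))"

end

theory Submission
  imports Defs
begin

text \<open>
  A graph of treewidth at most 2 is a partial 2-tree, and the edges of a 2-tree can be oriented
  coherently: below an edge with left end g and right end e, every triangle with apex x hangs the
  edges (g, x) to its left and (x, e) to its right.  This is the structure of a search tree.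

  A set of incomparable pairs (a, b) is reversed by some linear extension unless it contains an
  alternating cycle, that is, pairs with \<open>a i \<le> b (i + 1)\<close> for all i, cyclically.  Let c be the
  apex of the highest triangle met by the up-set of a.  Pairs with b outside the part of the 2-tree
  below c are reversed by two depth-first orders; the dual statement uses two more.  Up to duality and
  mirror images, the remaining pairs have b to the right of c, and b has a lower bound outside the
  part below c.  Then every edge below c that has a and b both below it has its left end above a and
  its right end below b, so the two ends of an edge never exchange their roles.  Hence, after
  splitting such pairs into two classes, every step of a shortest alternating cycle moves the place
  where a and b separate to the same side, and there is no such cycle.  Altogether
  \<open>4 + 4 \<cdot> 2 = 12\<close> linear extensions suffice.
\<close>

text \<open>The obstacle is a step from (a, b) to (a', b') towards the wrong side. Such a step
  passes through the left end \<gamma> of an edge, so that a \<le> \<gamma> \<le> b', and at or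
  below this edge there is one with ends \<gamma>' and \<beta>' such that \<gamma> \<le> \<gamma>'
  \<le> \<beta>'. This comparable edge acts as a barrier. A pair (a1, b1) below it has its apex
  below it as well, because otherwise a1 \<le> \<gamma>' \<le> \<beta>' \<le> b1. So the cycle can
  leave the part below the barrier only through some b2 inside it that has a lower bound outside,
  and this bound enters through an end above \<gamma>. Hence a \<le> b2, the cycle could have gone
  there directly from (a, b), and a shortest cycle contains no such step.

  The order enters through a single property: a comparability that leaves a region of the 2-tree
  passes through an end of the edge of that region. The cover graph is used only to establish
  this.\<close>

section \<open>Acyclic relations\<close>

text \<open>
  A shortest cycle has no step (i, j) in B: it must leave F after j, and by the last assumption the
  step out of F could be taken directly from i.
\<close>

lemma acyclic_shortcut:
  fixes R :: "'b rel"
  assumes irrefl: "\<And>i. (i, i) \<notin> R"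
    and good: "acyclic {(i, j) \<in> R. \<not> B i j}"
    and shortcut: "\<And>i j. (i, j) \<in> R \<Longrightarrow> B i j \<Longrightarrow>
      \<exists>F. j \<in> F \<and> i \<notin> F \<and> (\<forall>p q. (p, q) \<in> R \<longrightarrow> p \<in> F \<longrightarrow> q \<notin> F \<longrightarrow> (i, q) \<in> R)"
  shows "acyclic R"
proof -
  have "(x, x) \<notin> R ^^ Suc n" for x n
  proof (induction n arbitrary: x rule: less_induct)
    case (less n)
    show ?case
    proof
      assume cyc: "(x, x) \<in> R ^^ Suc n"
      define G where "G = {(i, j) \<in> R. \<not> B i j}"
      have no_bad: "\<not> B i j" if "(x, i) \<in> R ^^ k" and ij: "(i, j) \<in> R" and ji: "(j, x) \<in> R ^^ l" "k + l = n" for i j k l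
      proof
        assume "B i j"
        then obtain F where F: "j \<in> F" "i \<notin> F"
          and ex: "\<And>p q. (p, q) \<in> R \<Longrightarrow> p \<in> F \<Longrightarrow> q \<notin> F \<Longrightarrow> (i, q) \<in> R"
          using shortcut[OF ij] by blast
        have "(j, i) \<in> R ^^ l O R ^^ k"
          using ji(1) that(1) by blast
        then have ji': "(j, i) \<in> R ^^ n"
          using ji(2) by (simp add: relpow_add[symmetric] add.commute)
        \<comment> \<open>The walk from \<open>j\<close> back to \<open>i\<close> has only
          \<open>n\<close> steps. Replacing its part up to an exit from \<open>F\<close> by the
          direct step from \<open>i\<close> gives a closed walk shorter than \<open>Suc n\<close>,
          against the induction hypothesis.\<close>
        have "\<exists>k'<m. (i, i) \<in> R ^^ Suc k'" if "(s, i) \<in> R ^^ m" "s \<in> F" for s m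
          using that
        proof (induction m arbitrary: s)
          case 0
          then show ?case using F(2) by simp
        next
          case (Suc m)
          then obtain s' where s': "(s, s') \<in> R" "(s', i) \<in> R ^^ m"
            by (metis relpow_Suc_E2)
          show ?case
          proof (cases "s' \<in> F")
            case True
            then show ?thesis using Suc.IH s' less_SucI by blast
          next
            case False
            then have "(i, s') \<in> R" using ex s' Suc.prems by blast
            then have "(i, i) \<in> R ^^ Suc m" using s'(2) by (rule relpow_Suc_I2)
            then show ?thesis by blast
          qed
        qed
        from this[OF ji' F(1)] show False using less.IH by blast
      qed
      have "(x, y) \<in> G ^^ k" if "(x, y) \<in> R ^^ k" "(y, x) \<in> R ^^ l" "k + l = Suc n" for y k l
        using that
      proof (induction k arbitrary: y l)
        case 0
        then show ?case by simp
      next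
        case (Suc k)
        then obtain z where z: "(x, z) \<in> R ^^ k" "(z, y) \<in> R" by auto
        have "(z, x) \<in> R ^^ Suc l" using z(2) Suc.prems(2) by (rule relpow_Suc_I2)
        then have "(x, z) \<in> G ^^ k" using Suc.IH[of z "Suc l"] z(1) Suc.prems(3) by simp
        moreover have "(z, y) \<in> G"
          using no_bad[OF z Suc.prems(2)] z(2) Suc.prems(3) by (simp add: G_def)
        ultimately show ?case by auto
      qed
      from this[of x "Suc n" 0] cyc have "(x, x) \<in> G ^^ Suc n" by simp
      then have "(x, x) \<in> G\<^sup>+" using trancl_power[of "(x, x)" G] by blast
      then show False using good by (simp add: acyclic_def G_def)
    qed
  qed
  then show ?thesis
    unfolding acyclic_def trancl_power by (metis gr0_conv_Suc)
qed

text \<open>A potential that never increases along \<open>R\<close> is constant on every closed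
  walk, so a closed walk stays within one level.\<close>

lemma acyclic_levels:
  fixes f :: "'b \<Rightarrow> nat"
  assumes "\<And>i j. (i, j) \<in> R \<Longrightarrow> f j \<le> f i"
    and "\<And>k. acyclic {(i, j) \<in> R. f i = k \<and> f j = k}"
  shows "acyclic R"
proof (rule acyclicI, intro allI notI)
  fix x assume "(x, x) \<in> R\<^sup>+"
  have le: "f j \<le> f i" if "(i, j) \<in> R\<^sup>*" for i j
    using that by induction (auto dest: assms(1))
  have "(x, y) \<in> {(i, j) \<in> R. f i = f x \<and> f j = f x}\<^sup>+" if "(x, y) \<in> R\<^sup>+" "(y, x) \<in> R\<^sup>*" for y
    using that
  proof (induction rule: trancl_induct)
    case (base y)
    then show ?case using le[of y x] assms(1)[of x y] by (auto intro!: r_into_trancl)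
  next
    case (step y z)
    have yx: "(y, x) \<in> R\<^sup>*" using step by auto
    have "f y = f x" "f z = f x"
      using le[OF yx] le[OF trancl_into_rtrancl[OF step(1)]] le[OF step.prems] assms(1)[OF step(2)] by auto
    then have "(y, z) \<in> {(i, j) \<in> R. f i = f x \<and> f j = f x}" using step by auto
    then show ?case using step.IH[OF yx] by (meson trancl.trancl_into_trancl)
  qed
  from this[OF \<open>(x, x) \<in> R\<^sup>+\<close>] show False using assms(2)[of "f x"] by (auto simp: acyclic_def)
qed

section \<open>Oriented 2-trees\<close>

text \<open>
  A tree describes everything hanging below an oriented edge.  \<open>Node x L R N\<close> is a triangle with apex
  x on this edge; L hangs below its left side, R below its right side, and N holds the other
  triangles on the same edge.  An absent end of an edge is \<open>None\<close>.
\<close>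

datatype 'a ttree = Leaf | Node 'a "'a ttree" "'a ttree" "'a ttree"

primrec distinct_tree :: "'a ttree \<Rightarrow> bool" where
  "distinct_tree Leaf \<longleftrightarrow> True"
| "distinct_tree (Node x L R N) \<longleftrightarrow> x \<notin> set_ttree L \<and> x \<notin> set_ttree R \<and> x \<notin> set_ttree N \<and>
     set_ttree L \<inter> set_ttree R = {} \<and> set_ttree L \<inter> set_ttree N = {} \<and> set_ttree R \<inter> set_ttree N = {} \<and>
     distinct_tree L \<and> distinct_tree R \<and> distinct_tree N"

text \<open>The truncated trees \<open>Node x L R Leaf\<close> describe the part below a single triangle.\<close>

primrec regions :: "'a option \<Rightarrow> 'a option \<Rightarrow> 'a ttree \<Rightarrow> ('a option \<times> 'a option \<times> 'a ttree) set" where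
  "regions g e Leaf = {(g, e, Leaf)}"
| "regions g e (Node x L R N) = {(g, e, Node x L R N), (g, e, Node x L R Leaf)} \<union>
     regions g (Some x) L \<union> regions (Some x) e R \<union> regions g e N"

lemma regions_refl [simp]: "(g, e, t) \<in> regions g e t" by (cases t) auto

lemma regions_Leaf [simp]: "(g, e, Leaf) \<in> regions g e t" by (induction t arbitrary: g e) auto

lemma regions_set: "(g', e', t') \<in> regions g e t \<Longrightarrow> set_ttree t' \<subseteq> set_ttree t"
  by (induction t arbitrary: g e) (simp, fastforce)

lemma regions_dist: "(g', e', t') \<in> regions g e t \<Longrightarrow> distinct_tree t \<Longrightarrow> distinct_tree t'"
  by (induction t arbitrary: g e) auto

lemma regions_trans: "A \<in> regions g' e' t' \<Longrightarrow> (g', e', t') \<in> regions g e t \<Longrightarrow> A \<in> regions g e t"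
  by (induction t arbitrary: g e) auto

lemma regions_ends:
  assumes "distinct_tree t" "(g', e', t') \<in> regions g e t" "(set_option g \<union> set_option e) \<inter> set_ttree t = {}"
  shows "(set_option g' \<union> set_option e') \<inter> set_ttree t' = {}"
  using assms
proof (induction t arbitrary: g e)
  case Leaf
  then show ?case by auto
next
  case (Node x L R N)
  have "(g', e') = (g, e) \<and> set_ttree t' \<subseteq> set_ttree (Node x L R N) \<or> (g', e', t') \<in> regions g (Some x) L \<or>
      (g', e', t') \<in> regions (Some x) e R \<or> (g', e', t') \<in> regions g e N"
    using Node.prems(2) by auto
  moreover have "(set_option g \<union> set_option (Some x)) \<inter> set_ttree L = {}"
    "(set_option (Some x) \<union> set_option e) \<inter> set_ttree R = {}"
    "(set_option g \<union> set_option e) \<inter> set_ttree N = {}"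
    using Node.prems(1,3) by auto
  moreover have "distinct_tree L" "distinct_tree R" "distinct_tree N" using Node.prems(1) by auto
  ultimately show ?case using Node.IH Node.prems(3) by blast
qed

text \<open>The whole tree contains its truncation, the truncation contains both sides, and
  \<open>N\<close> is disjoint from the truncation. The common vertex \<open>u\<close> excludes
  disjoint regions, in particular the empty ones.\<close>

lemma regions_laminar:
  assumes "distinct_tree t" "(g1, e1, t1) \<in> regions g e t" "(g2, e2, t2) \<in> regions g e t"
    and "u \<in> set_ttree t1" "u \<in> set_ttree t2"
  shows "(g1, e1, t1) \<in> regions g2 e2 t2 \<or> (g2, e2, t2) \<in> regions g1 e1 t1"
  using assms
proof (induction t arbitrary: g e)
  case Leaf
  then show ?case by auto
next
  case (Node x L R N)
  have cases: "(g', e', t') = (g, e, Node x L R N) \<or> (g', e', t') = (g, e, Node x L R Leaf) \<or>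
      (g', e', t') \<in> regions g (Some x) L \<and> u \<in> set_ttree L \<or>
      (g', e', t') \<in> regions (Some x) e R \<and> u \<in> set_ttree R \<or>
      (g', e', t') \<in> regions g e N \<and> u \<in> set_ttree N"
    if "(g', e', t') \<in> regions g e (Node x L R N)" "u \<in> set_ttree t'" for g' e' t'
    using that(1) regions_set[of g' e' t' g "Some x" L] regions_set[of g' e' t' "Some x" e R]
      regions_set[of g' e' t' g e N] that(2) by (simp only: regions.simps Un_iff insert_iff empty_iff) blast
  have d: "distinct_tree L" "distinct_tree R" "distinct_tree N" "set_ttree L \<inter> set_ttree R = {}" "set_ttree L \<inter> set_ttree N = {}"
    "set_ttree R \<inter> set_ttree N = {}" "x \<notin> set_ttree N"
    using Node.prems(1) by auto
  have trunc: "(g, e, Node x L R Leaf) \<in> regions g e (Node x L R N)"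
    "A \<in> regions g (Some x) L \<Longrightarrow> A \<in> regions g e (Node x L R Leaf)"
    "A \<in> regions (Some x) e R \<Longrightarrow> A \<in> regions g e (Node x L R Leaf)" for A
    by auto
  note c1 = cases[OF Node.prems(2,4)] and c2 = cases[OF Node.prems(3,5)]
  from c1 show ?case
  proof (elim disjE conjE)
    assume "(g1, e1, t1) = (g, e, Node x L R N)"
    then show ?thesis using Node.prems by blast
  next
    assume 1: "(g1, e1, t1) = (g, e, Node x L R Leaf)"
    have "u \<notin> set_ttree N" using 1 Node.prems(4) d by auto
    moreover have "g1 = g" "e1 = e" "t1 = Node x L R Leaf" using 1 by simp_all
    ultimately show ?thesis
      using c2 trunc(2,3)[of "(g2, e2, t2)"] by (elim disjE conjE) simp_all
  next
    assume 1: "(g1, e1, t1) \<in> regions g (Some x) L" "u \<in> set_ttree L"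
    then have "u \<notin> set_ttree R" "u \<notin> set_ttree N" using d by auto
    then show ?thesis using c2 Node.IH(1)[OF d(1) 1(1) _ Node.prems(4,5)] trunc(2)[OF 1(1)] Node.prems(2)
      by (auto simp del: regions.simps)
  next
    assume 1: "(g1, e1, t1) \<in> regions (Some x) e R" "u \<in> set_ttree R"
    then have "u \<notin> set_ttree L" "u \<notin> set_ttree N" using d by auto
    then show ?thesis using c2 Node.IH(2)[OF d(2) 1(1) _ Node.prems(4,5)] trunc(3)[OF 1(1)] Node.prems(2)
      by (auto simp del: regions.simps)
  next
    assume 1: "(g1, e1, t1) \<in> regions g e N" "u \<in> set_ttree N"
    then have "u \<notin> set_ttree L" "u \<notin> set_ttree R" "u \<noteq> x" using d by auto
    then have "(g2, e2, t2) \<noteq> (g, e, Node x L R Leaf)" using Node.prems(5) by auto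
    then show ?thesis
      using c2 \<open>u \<notin> set_ttree L\<close> \<open>u \<notin> set_ttree R\<close> Node.IH(3)[OF d(3) 1(1) _ Node.prems(4,5)] Node.prems(2)
      by (auto simp del: regions.simps)
  qed
qed

section \<open>Acyclicity of alternating cycles\<close>

text \<open>The ends of the edge of a region cut it off in the 2-tree; only the consequence for the
  order is kept here. The outer element \<open>v\<close> may itself be an end.\<close>

definition separating :: "'a rel \<Rightarrow> 'a ttree \<Rightarrow> bool" where
  "separating r t \<longleftrightarrow> (\<forall>(g, e, s) \<in> regions None None t. \<forall>u \<in> set_ttree s. \<forall>v \<in> set_ttree t - set_ttree s.
     ((u, v) \<in> r \<longrightarrow> (\<exists>z \<in> set_option g \<union> set_option e. (u, z) \<in> r \<and> (z, v) \<in> r)) \<and>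
     ((v, u) \<in> r \<longrightarrow> (\<exists>z \<in> set_option g \<union> set_option e. (v, z) \<in> r \<and> (z, u) \<in> r)))"

text \<open>These assumptions survive both mirroring the tree and dualizing the order, so every
  result below is available in four versions.\<close>

locale tree_poset =
  fixes X :: "'a set" and r :: "'a rel" and t0 :: "'a ttree"
  assumes po: "partial_order_on X r"
    and distinct_tree: "distinct_tree t0" and set_t0: "set_ttree t0 = X" and sep: "separating r t0"
begin

abbreviation le (infix "\<preceq>" 50) where "x \<preceq> y \<equiv> (x, y) \<in> r"

abbreviation region :: "'a option \<Rightarrow> 'a option \<Rightarrow> 'a ttree \<Rightarrow> bool" where
  "region g e t \<equiv> (g, e, t) \<in> regions None None t0"

lemma le_X: "x \<preceq> y \<Longrightarrow> x \<in> X" "x \<preceq> y \<Longrightarrow> y \<in> X"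
  and le_refl: "x \<in> X \<Longrightarrow> x \<preceq> x"
  and le_trans [trans]: "x \<preceq> y \<Longrightarrow> y \<preceq> z \<Longrightarrow> x \<preceq> z"
  and le_antisym: "x \<preceq> y \<Longrightarrow> y \<preceq> x \<Longrightarrow> x = y"
  using po unfolding partial_order_on_def preorder_on_def refl_on_def trans_def antisym_def
  by blast+

lemma region_X: "region g e t \<Longrightarrow> u \<in> set_ttree t \<Longrightarrow> u \<in> X"
  using regions_set set_t0 by blast

lemma sep_up:
  assumes "region g e t" "u \<in> set_ttree t" "v \<notin> set_ttree t" "u \<preceq> v"
  obtains z where "g = Some z \<or> e = Some z" "u \<preceq> z" "z \<preceq> v"
proof -
  have "v \<in> set_ttree t0 - set_ttree t" using assms le_X set_t0 by auto
  then show ?thesis using assms sep that unfolding separating_def by fastforce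
qed

lemma sep_down:
  assumes "region g e t" "u \<in> set_ttree t" "v \<notin> set_ttree t" "v \<preceq> u"
  obtains z where "g = Some z \<or> e = Some z" "v \<preceq> z" "z \<preceq> u"
proof -
  have "v \<in> set_ttree t0 - set_ttree t" using assms le_X set_t0 by auto
  then show ?thesis using assms sep that unfolding separating_def by fastforce
qed

text \<open>Here c is the apex of the highest triangle met by the up-set of a.\<close>

definition right_witness :: "'a \<Rightarrow> 'a \<Rightarrow> 'a option \<Rightarrow> 'a option \<Rightarrow> 'a \<Rightarrow> 'a ttree \<Rightarrow> 'a ttree \<Rightarrow> bool" where
  "right_witness a b g e c L R \<longleftrightarrow> region g e (Node c L R Leaf) \<and> (\<forall>z. a \<preceq> z \<longrightarrow> z \<in> set_ttree (Node c L R Leaf)) \<and>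
     a \<preceq> c \<and> b \<in> set_ttree R \<and> \<not> a \<preceq> b \<and> (\<exists>y. y \<preceq> b \<and> y \<notin> set_ttree (Node c L R Leaf))"

definition right_pair :: "'a \<Rightarrow> 'a \<Rightarrow> bool" where
  "right_pair a b \<longleftrightarrow> (\<exists>g e c L R. right_witness a b g e c L R)"

lemma right_witness_in:
  assumes "right_witness a b g e c L R"
  shows "a \<in> set_ttree (Node c L R Leaf)" "b \<in> set_ttree (Node c L R Leaf)" "c \<notin> set_ttree L" "c \<notin> set_ttree R"
    "set_ttree L \<inter> set_ttree R = {}"
proof -
  have "a \<in> X" using assms le_X unfolding right_witness_def by blast
  then show "a \<in> set_ttree (Node c L R Leaf)" using assms le_refl unfolding right_witness_def by blast
  show "b \<in> set_ttree (Node c L R Leaf)" using assms unfolding right_witness_def by auto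
  have "distinct_tree (Node c L R Leaf)" using assms distinct_tree regions_dist unfolding right_witness_def by blast
  then show "c \<notin> set_ttree L" "c \<notin> set_ttree R" "set_ttree L \<inter> set_ttree R = {}" by auto
qed

text \<open>Both \<open>c\<close>, above \<open>a\<close>, and \<open>y\<close>, below
  \<open>b\<close>, lie outside. On entering a left side, \<open>y\<close> must reach
  \<open>b\<close> through the new right end \<open>x\<close>, since a passage through the left end,
  which is above \<open>a\<close>, would give a \<le> b. On entering a right side, \<open>a\<close>
  must likewise reach \<open>c\<close> through the new left end \<open>x\<close>.\<close>

lemma split_edge_aux:
  assumes ab: "\<not> a \<preceq> b" and ac: "a \<preceq> c" and yb: "y \<preceq> b"
  shows "(g', e', t') \<in> regions g e t \<Longrightarrow> region g e t \<Longrightarrow> a \<in> set_ttree t' \<Longrightarrow> b \<in> set_ttree t' \<Longrightarrow>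
    c \<notin> set_ttree t \<Longrightarrow> y \<notin> set_ttree t \<Longrightarrow>
    g = Some \<gamma> \<Longrightarrow> a \<preceq> \<gamma> \<Longrightarrow> e = Some \<beta> \<Longrightarrow> \<beta> \<preceq> b \<Longrightarrow>
    \<exists>\<gamma>' \<beta>'. g' = Some \<gamma>' \<and> e' = Some \<beta>' \<and> a \<preceq> \<gamma>' \<and> \<beta>' \<preceq> b"
proof (induction t arbitrary: g e \<gamma> \<beta>)
  case Leaf
  then show ?case by auto
next
  case (Node x L R N)
  have regL: "region g (Some x) L" and regR: "region (Some x) e R" and regN: "region g e N"
    using regions_trans[OF _ Node.prems(2)] by auto
  consider "(g', e') = (g, e)" | "(g', e', t') \<in> regions g (Some x) L" | "(g', e', t') \<in> regions (Some x) e R"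
    | "(g', e', t') \<in> regions g e N"
    using Node.prems(1) by auto
  then show ?case
  proof cases
    case 1
    then show ?thesis using Node.prems by auto
  next
    case 2
    then have "b \<in> set_ttree L" using Node.prems regions_set by blast
    then obtain z where "g = Some z \<or> Some x = Some z" "y \<preceq> z" "z \<preceq> b"
      using sep_down[OF regL _ _ yb] Node.prems(6) by auto
    then have "x \<preceq> b" using Node.prems(7,8) ab le_trans by blast
    then show ?thesis using Node.IH(1)[OF 2 regL] Node.prems by auto
  next
    case 3
    then have "a \<in> set_ttree R" using Node.prems regions_set by blast
    then obtain z where "Some x = Some z \<or> e = Some z" "a \<preceq> z" "z \<preceq> c"
      using sep_up[OF regR _ _ ac] Node.prems(5) by auto
    then have "a \<preceq> x" using Node.prems(9,10) ab le_trans by blast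
    then show ?thesis using Node.IH(2)[OF 3 regR] Node.prems by auto
  next
    case 4
    then show ?thesis using Node.IH(3)[OF 4 regN] Node.prems by auto
  qed
qed

text \<open>A region that contains \<open>a\<close> and \<open>b\<close> but not \<open>c\<close>
  lies below the right side of the triangle. There the roles are right from the start: the left end
  is \<open>c\<close>, and the outside lower bound of \<open>b\<close> enters through
  \<open>e\<close>, since through \<open>c\<close> it would give a \<le> c \<le> b.\<close>

lemma split_edge:
  assumes w: "right_witness a b g e c L R" and t: "region g' e' t'" "a \<in> set_ttree t'" "b \<in> set_ttree t'" "c \<notin> set_ttree t'"
  obtains \<gamma> \<beta> where "g' = Some \<gamma>" "e' = Some \<beta>" "a \<preceq> \<gamma>" "\<beta> \<preceq> b"
    "set_ttree t' \<subseteq> set_ttree R"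
proof -
  have c: "region g e (Node c L R Leaf)" using w by (simp add: right_witness_def)
  have notsub: "(g, e, Node c L R Leaf) \<notin> regions g' e' t'"
    using regions_set[of g e "Node c L R Leaf" g' e' t'] t(4) by auto
  have bL: "b \<notin> set_ttree L" "b \<in> set_ttree R" using right_witness_in[OF w] w unfolding right_witness_def by auto
  have "(g', e', t') \<in> regions g e (Node c L R Leaf)"
    using regions_laminar[OF distinct_tree t(1) c t(3)] right_witness_in[OF w] notsub by blast
  then have tR: "(g', e', t') \<in> regions (Some c) e R"
    using t bL regions_set[of g' e' t' g "Some c" L] by auto
  have regR: "region (Some c) e R" using regions_trans[OF _ c] by auto
  obtain y where y: "y \<preceq> b" "y \<notin> set_ttree (Node c L R Leaf)" using w unfolding right_witness_def by blast
  have acb: "a \<preceq> c" "\<not> a \<preceq> b" using w unfolding right_witness_def by auto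
  obtain z where z: "Some c = Some z \<or> e = Some z" "y \<preceq> z" "z \<preceq> b"
    using sep_down[OF regR bL(2) _ y(1)] y(2) by auto
  then have "z \<noteq> c" using acb le_trans by blast
  then have "e = Some z" using z by auto
  then show thesis
    using split_edge_aux[OF acb(2) acb(1) y(1) tR regR] t acb(1) z(3) right_witness_in[OF w] y(2) that
      regions_set[OF tR] by auto
qed

section \<open>Steps of alternating cycles and their shortcuts\<close>

definition alternating :: "('a \<times> 'a) rel" where
  "alternating = {((a, b), (a', b')). right_pair a b \<and> right_pair a' b' \<and> a \<preceq> b'}"

text \<open>The set \<open>F\<close> of \<open>acyclic_shortcut\<close>, stated without reference to
  the class of pairs: for right pairs, \<open>fst i \<preceq> snd q\<close> makes (i, q) a
  step.\<close>

definition shortcut :: "('a \<times> 'a) \<Rightarrow> ('a \<times> 'a) \<Rightarrow> bool" where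
  "shortcut i j \<longleftrightarrow> (\<exists>F. j \<in> F \<and> i \<notin> F \<and>
     (\<forall>p q. (p, q) \<in> alternating \<longrightarrow> p \<in> F \<longrightarrow> q \<notin> F \<longrightarrow> fst i \<preceq> snd q))"

lemma region_ends: "region g e t \<Longrightarrow> g = Some z \<or> e = Some z \<Longrightarrow> z \<notin> set_ttree t"
  using regions_ends[OF distinct_tree] by fastforce

text \<open>By laminarity the alternative is that the region lies properly inside the triangle,
  hence below one of its sides, where \<open>c\<close> does not occur.\<close>

lemma node_in:
  assumes t: "region g e t" and c: "region g' e' (Node c L R Leaf)" and "c \<in> set_ttree t"
  shows "(g', e', Node c L R Leaf) \<in> regions g e t"
proof -
  have "c \<notin> set_ttree L" "c \<notin> set_ttree R" using regions_dist[OF c distinct_tree] by auto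
  then have "(g, e, t) \<notin> regions g' (Some c) L" "(g, e, t) \<notin> regions (Some c) e' R"
    using regions_set assms(3) by blast+
  then show ?thesis using regions_laminar[OF distinct_tree t c assms(3)] assms(3) by auto
qed

text \<open>
  When a right pair lies below an edge whose left end is at most its right end, the witnessing apex
  lies below that edge, too; a step out of the region leads to a pair (a, b) with b above the left end.
\<close>

lemma blocked:
  assumes "region g e t" "\<gamma> \<notin> set_ttree t" "(g', Some z, Node c L R Leaf) \<in> regions g e t" "\<gamma> \<preceq> z"
    "\<And>w. e = Some w \<Longrightarrow> \<not> \<gamma> \<preceq> w"
  shows "\<exists>\<gamma>' \<beta>' s. (Some \<gamma>', Some \<beta>', s) \<in> regions g e t \<and> \<gamma> \<preceq> \<gamma>' \<and> \<gamma>' \<preceq> \<beta>' \<and>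
    (g', Some z, Node c L R Leaf) \<in> regions (Some \<gamma>') (Some \<beta>') s"
  using assms
proof (induction t arbitrary: g e)
  case Leaf
  then show ?case by auto
next
  case (Node x L1 R1 N1)
  have regL: "region g (Some x) L1" and regR: "region (Some x) e R1" and regN: "region g e N1"
    using regions_trans[OF _ Node.prems(1)] by auto
  have notin: "\<gamma> \<notin> set_ttree L1" "\<gamma> \<notin> set_ttree R1" "\<gamma> \<notin> set_ttree N1" using Node.prems(2) by auto
  have "e \<noteq> Some z" using Node.prems(4,5) by auto
  then consider "(g', Some z, Node c L R Leaf) \<in> regions g (Some x) L1"
    | "(g', Some z, Node c L R Leaf) \<in> regions (Some x) e R1" | "(g', Some z, Node c L R Leaf) \<in> regions g e N1"
    using Node.prems(3) by auto
  then show ?case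
  proof cases
    case 1
    show ?thesis
    proof (cases "\<gamma> \<preceq> x")
      case True
      \<comment> \<open>The right end changes only on entering a left side, and here it becomes
        \<open>x\<close>, above \<open>\<gamma>\<close>, for the first time. Some end lies between
        \<open>\<gamma>\<close> and \<open>x\<close>; it cannot be the old right end, so it is the
        left end, and the edge to \<open>x\<close> is comparable.\<close>
      then obtain w where w: "g = Some w \<or> e = Some w" "\<gamma> \<preceq> w" "w \<preceq> x"
        using sep_down[OF Node.prems(1) _ Node.prems(2), of x] by auto
      then have "g = Some w" using Node.prems(5) by auto
      then show ?thesis using w 1 by (intro exI[of _ w] exI[of _ x] exI[of _ L1]) auto
    next
      case False
      then obtain \<gamma>' \<beta>' s where "(Some \<gamma>', Some \<beta>', s) \<in> regions g (Some x) L1" "\<gamma> \<preceq> \<gamma>'" "\<gamma>' \<preceq> \<beta>'"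
        "(g', Some z, Node c L R Leaf) \<in> regions (Some \<gamma>') (Some \<beta>') s"
        using Node.IH(1)[OF regL notin(1) 1 Node.prems(4)] by blast
      then show ?thesis by (intro exI[of _ \<gamma>'] exI[of _ \<beta>'] exI[of _ s]) auto
    qed
  next
    case 2
    obtain \<gamma>' \<beta>' s where "(Some \<gamma>', Some \<beta>', s) \<in> regions (Some x) e R1" "\<gamma> \<preceq> \<gamma>'" "\<gamma>' \<preceq> \<beta>'"
      "(g', Some z, Node c L R Leaf) \<in> regions (Some \<gamma>') (Some \<beta>') s"
      using Node.IH(2)[OF regR notin(2) 2 Node.prems(4,5)] by blast
    then show ?thesis by (intro exI[of _ \<gamma>'] exI[of _ \<beta>'] exI[of _ s]) auto
  next
    case 3
    obtain \<gamma>' \<beta>' s where "(Some \<gamma>', Some \<beta>', s) \<in> regions g e N1" "\<gamma> \<preceq> \<gamma>'" "\<gamma>' \<preceq> \<beta>'"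
      "(g', Some z, Node c L R Leaf) \<in> regions (Some \<gamma>') (Some \<beta>') s"
      using Node.IH(3)[OF regN notin(3) 3 Node.prems(4,5)] by blast
    then show ?thesis by (intro exI[of _ \<gamma>'] exI[of _ \<beta>'] exI[of _ s]) auto
  qed
qed

lemma shortcutI:
  assumes t: "region (Some \<gamma>) e t" and a: "a \<notin> set_ttree t" "a \<preceq> \<gamma>"
    and w: "right_witness a' b' g' e' c L R" and c: "c \<in> set_ttree t" and \<gamma>b: "\<gamma> \<preceq> b'"
  shows "shortcut (a, b) (a', b')"
proof -
  have regc: "region g' e' (Node c L R Leaf)" and a'c: "a' \<preceq> c" and ab': "\<not> a' \<preceq> b'" and b'R: "b' \<in> set_ttree R"
    using w by (auto simp: right_witness_def)
  have cin: "(g', e', Node c L R Leaf) \<in> regions (Some \<gamma>) e t" using node_in[OF t regc c] .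
  have \<gamma>t: "\<gamma> \<notin> set_ttree t" using region_ends[OF t] by auto
  have regR: "region (Some c) e' R" using regions_trans[OF _ regc] by auto
  have "\<gamma> \<notin> set_ttree R" using regions_set[OF cin] \<gamma>t by auto
  \<comment> \<open>The passage from \<open>\<gamma>\<close> to \<open>b'\<close> uses
    \<open>e'\<close>, because through \<open>c\<close> it would give a' \<le> c \<le> b'.\<close>
  then obtain z where z: "Some c = Some z \<or> e' = Some z" "\<gamma> \<preceq> z" "z \<preceq> b'"
    using sep_down[OF regR b'R _ \<gamma>b] by blast
  then have e': "e' = Some z" using a'c ab' le_trans by blast
  obtain \<gamma>' \<beta>' s where s: "(Some \<gamma>', Some \<beta>', s) \<in> regions (Some \<gamma>) e t" "\<gamma> \<preceq> \<gamma>'" "\<gamma>' \<preceq> \<beta>'"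
    "(g', Some z, Node c L R Leaf) \<in> regions (Some \<gamma>') (Some \<beta>') s"
  proof (cases "\<exists>v. e = Some v \<and> \<gamma> \<preceq> v")
    case True
    then obtain v where v: "e = Some v" "\<gamma> \<preceq> v" by blast
    have "(Some \<gamma>, Some v, t) \<in> regions (Some \<gamma>) e t" "\<gamma> \<preceq> \<gamma>" "\<gamma> \<preceq> v"
      "(g', Some z, Node c L R Leaf) \<in> regions (Some \<gamma>) (Some v) t"
      using v cin e' le_refl le_X a by auto
    then show thesis by (rule that)
  next
    case False
    then show thesis using blocked[OF t \<gamma>t _ z(2)] cin e' that by blast
  qed
  have regions: "region (Some \<gamma>') (Some \<beta>') s" using regions_trans[OF s(1) t] .
  have st: "set_ttree s \<subseteq> set_ttree t" using regions_set[OF s(1)] .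
  have cs: "set_ttree (Node c L R Leaf) \<subseteq> set_ttree s" using regions_set[OF s(4)] .
  have \<gamma>\<beta>: "\<gamma> \<preceq> \<beta>'" using s le_trans by blast
  define F where "F = {(p, q). p \<in> set_ttree s \<and> q \<in> set_ttree s}"
  have "(a', b') \<in> F" using right_witness_in(1,2)[OF w] cs by (auto simp: F_def)
  moreover have "(a, b) \<notin> F" using a st by (auto simp: F_def)
  moreover have "a \<preceq> b2" if p: "(a1, b1) \<in> F" and q: "(a2, b2) \<notin> F" and pl: "right_pair a1 b1" "right_pair a2 b2"
    and le: "a1 \<preceq> b2" for a1 b1 a2 b2
  proof -
    obtain g1 e1 c1 L1 R1 where w1: "right_witness a1 b1 g1 e1 c1 L1 R1" using pl by (auto simp: right_pair_def)
    obtain g2 e2 c2 L2 R2 where w2: "right_witness a2 b2 g2 e2 c2 L2 R2" using pl by (auto simp: right_pair_def)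
    \<comment> \<open>With its apex outside, \<open>split_edge\<close> would give a1 \<le> \<gamma>'
      \<le> \<beta>' \<le> b1. So the whole up-set of \<open>a1\<close> stays in \<open>s\<close>,
      and an exit from \<open>F\<close> can only mean that \<open>a2\<close> is outside.\<close>
    have c1: "c1 \<in> set_ttree s"
    proof (rule ccontr)
      assume "c1 \<notin> set_ttree s"
      then have "a1 \<preceq> \<gamma>'" "\<beta>' \<preceq> b1"
        using split_edge[OF w1 regions] p by (auto simp: F_def)
      then have "a1 \<preceq> b1" using s(3) le_trans by blast
      then show False using w1 by (simp add: right_witness_def)
    qed
    have "region g1 e1 (Node c1 L1 R1 Leaf)" using w1 by (simp add: right_witness_def)
    from regions_set[OF node_in[OF regions this c1]] have "b2 \<in> set_ttree s"
      using w1 le unfolding right_witness_def by blast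
    then have a2: "a2 \<notin> set_ttree s" using q by (simp add: F_def)
    have regc2: "region g2 e2 (Node c2 L2 R2 Leaf)" using w2 by (simp add: right_witness_def)
    \<comment> \<open>The triangle of \<open>a2\<close> shares \<open>b2\<close> with
      \<open>s\<close> but is not contained in \<open>s\<close>, so it surrounds \<open>s\<close>. A
      lower bound of \<open>b2\<close> outside that triangle then enters \<open>s\<close> through
      one of its ends, and both ends are above \<open>\<gamma>\<close>.\<close>
    have "(Some \<gamma>', Some \<beta>', s) \<in> regions g2 e2 (Node c2 L2 R2 Leaf)"
      using regions_laminar[OF distinct_tree regions regc2 \<open>b2 \<in> set_ttree s\<close>] right_witness_in(1,2)[OF w2] a2 regions_set by blast
    then have "set_ttree s \<subseteq> set_ttree (Node c2 L2 R2 Leaf)" by (rule regions_set)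
    moreover obtain y where y: "y \<preceq> b2" "y \<notin> set_ttree (Node c2 L2 R2 Leaf)"
      using w2 unfolding right_witness_def by blast
    ultimately obtain v where "Some \<gamma>' = Some v \<or> Some \<beta>' = Some v" "v \<preceq> b2"
      using sep_down[OF regions \<open>b2 \<in> set_ttree s\<close> _ y(1)] by blast
    then have "\<gamma> \<preceq> b2" using s(2) \<gamma>\<beta> le_trans by blast
    then show ?thesis using a(2) le_trans by blast
  qed
  ultimately show ?thesis unfolding shortcut_def alternating_def
    by (intro exI[of _ F]) auto
qed

text \<open>
  The first class contains the pairs separated by two triangles on one edge with the triangle of a
  in front, and the pairs separated by an apex above a; the second class contains the others.
\<close>

primrec cut_class :: "'a ttree \<Rightarrow> 'a \<Rightarrow> 'a \<Rightarrow> bool" where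
  "cut_class Leaf a b \<longleftrightarrow> True"
| "cut_class (Node x L R N) a b \<longleftrightarrow>
     (if a \<in> set_ttree N \<and> b \<in> set_ttree N then cut_class N a b
      else if a \<in> set_ttree L \<and> b \<in> set_ttree L then cut_class L a b
      else if a \<in> set_ttree R \<and> b \<in> set_ttree R then cut_class R a b
      else if b \<in> set_ttree N then True
      else if a \<in> set_ttree N then False
      else a \<preceq> x)"

end

section \<open>Steps without shortcut move to one side\<close>

context tree_poset begin

text \<open>As \<open>s\<close> and \<open>t\<close> hang on the same edge, a \<le> b' passes
  through an end of it. So the up-set of \<open>a\<close> leaves \<open>t\<close>, and
  \<open>split_edge\<close> puts \<open>a\<close> below the left end and \<open>b\<close> above the
  right end. A passage through the right end would give a \<le> b; hence it is the left end, which
  serves as the \<open>\<gamma>\<close> of \<open>shortcutI\<close>.\<close>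

lemma crossing_bad:
  assumes t: "region g e t" and a: "a \<in> set_ttree t" and b: "b \<in> set_ttree t" and ab: "right_pair a b"
    and a'b': "right_witness a' b' g' e' c L R" "a' \<in> set_ttree t" "b' \<in> set_ttree t" and ab': "a \<preceq> b'"
    and s: "region g e s" "set_ttree s \<subseteq> set_ttree t" "a \<notin> set_ttree s" "b' \<in> set_ttree s"
    and sc: "c \<in> set_ttree t \<Longrightarrow> c \<in> set_ttree s"
  shows "shortcut (a, b) (a', b')"
proof -
  obtain z where z: "g = Some z \<or> e = Some z" "a \<preceq> z" "z \<preceq> b'"
    using sep_down[OF s(1,4,3) ab'] by blast
  then have zt: "z \<notin> set_ttree t" using region_ends[OF t] by blast
  obtain g1 e1 c1 L1 R1 where w1: "right_witness a b g1 e1 c1 L1 R1" using ab by (auto simp: right_pair_def)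
  have "c1 \<notin> set_ttree t"
  proof
    assume "c1 \<in> set_ttree t"
    moreover have "region g1 e1 (Node c1 L1 R1 Leaf)" using w1 by (simp add: right_witness_def)
    ultimately have "set_ttree (Node c1 L1 R1 Leaf) \<subseteq> set_ttree t" using node_in[OF t] regions_set by blast
    then show False using w1 z(2) zt unfolding right_witness_def by blast
  qed
  then obtain \<gamma> \<beta> where gb: "g = Some \<gamma>" "e = Some \<beta>" "a \<preceq> \<gamma>" "\<beta> \<preceq> b"
    using split_edge[OF w1 t a b] by blast
  have "\<not> a \<preceq> b" using w1 by (simp add: right_witness_def)
  then have "z \<noteq> \<beta>" using z gb le_trans by blast
  then have "z = \<gamma>" using z gb by auto
  then have \<gamma>b': "\<gamma> \<preceq> b'" using z by simp
  have "c \<in> set_ttree t"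
  proof (rule ccontr)
    assume "c \<notin> set_ttree t"
    then have "a' \<preceq> \<gamma>" using split_edge[OF a'b'(1) t a'b'(2,3)] gb by auto
    then show False using a'b'(1) \<gamma>b' le_trans unfolding right_witness_def by blast
  qed
  then have "c \<in> set_ttree s" by (rule sc)
  moreover have "region (Some \<gamma>) e s" using s(1) gb by simp
  ultimately show ?thesis using shortcutI[OF _ s(3) gb(3) a'b'(1) _ \<gamma>b'] by blast
qed

lemma node_cases:
  assumes t: "region g e (Node x L R N)" and w: "right_witness a b g' e' c L' R'" and c: "c \<in> set_ttree (Node x L R N)"
  shows "c = x \<and> L' = L \<and> R' = R \<or> c \<in> set_ttree L \<and> a \<in> set_ttree L \<and> b \<in> set_ttree L \<or>
    c \<in> set_ttree R \<and> a \<in> set_ttree R \<and> b \<in> set_ttree R \<or> c \<in> set_ttree N \<and> a \<in> set_ttree N \<and> b \<in> set_ttree N"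
proof -
  have regc: "region g' e' (Node c L' R' Leaf)" using w by (simp add: right_witness_def)
  have regions: "region g (Some x) L" "region (Some x) e R" "region g e N" using regions_trans[OF _ t] by auto
  have d: "distinct_tree (Node x L R N)" using regions_dist[OF t distinct_tree] .
  have in_sub: "a \<in> set_ttree s \<and> b \<in> set_ttree s" if "region g1 e1 s" "c \<in> set_ttree s" for g1 e1 s
    using regions_set[OF node_in[OF that(1) regc that(2)]] right_witness_in(1,2)[OF w] by blast
  have "L' = L \<and> R' = R" if "c = x"
    using node_in[OF t regc] that d
      regions_set[of g' e' "Node c L' R' Leaf" g "Some x" L] regions_set[of g' e' "Node c L' R' Leaf" "Some x" e R]
      regions_set[of g' e' "Node c L' R' Leaf" g e N] by auto
  then show ?thesis using c in_sub regions by auto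
qed

text \<open>Otherwise \<open>a\<close> is \<open>x\<close> or on its right and \<open>b\<close> is
  \<open>x\<close> or on its left. This excludes an apex \<open>c\<close> inside the tree, so
  \<open>a\<close> must reach \<open>c\<close> outside and \<open>b\<close> is reached from outside.
  Both passages go through \<open>x\<close>, since the outer ends would give a \<le> b by
  \<open>split_edge\<close>; but then a \<le> x \<le> b.\<close>

lemma right_pair_cases:
  assumes t: "region g e (Node x L R N)" and ab: "right_pair a b"
    and a: "a \<in> set_ttree (Node x L R Leaf)" and b: "b \<in> set_ttree (Node x L R Leaf)"
  shows "a \<in> set_ttree L \<and> b \<in> set_ttree L \<or> a \<in> set_ttree R \<and> b \<in> set_ttree R \<or>
    a \<in> insert x (set_ttree L) \<and> b \<in> insert x (set_ttree R)"
proof (rule ccontr)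
  assume neg: "\<not> ?thesis"
  obtain g' e' c L' R' where w: "right_witness a b g' e' c L' R'" using ab by (auto simp: right_pair_def)
  have d: "distinct_tree (Node x L R N)" using regions_dist[OF t distinct_tree] .
  have nab: "\<not> a \<preceq> b" and ac: "a \<preceq> c" using w by (auto simp: right_witness_def)
  have "a \<in> X" using ac le_X by blast
  then have "a \<noteq> b" using nab le_refl by blast
  then have ab': "a \<in> insert x (set_ttree R)" "b \<in> insert x (set_ttree L)" using neg a b by auto
  have c: "c \<notin> set_ttree (Node x L R N)"
  proof
    assume "c \<in> set_ttree (Node x L R N)"
    from node_cases[OF t w this] show False
      using ab' d neg w a b unfolding right_witness_def by auto
  qed
  have regions: "region g (Some x) L" "region (Some x) e R" "region g e (Node x L R Leaf)" using regions_trans[OF _ t] by auto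
  have c': "c \<notin> set_ttree (Node x L R Leaf)" using c by auto
  obtain \<gamma> \<beta> where gb: "g = Some \<gamma>" "e = Some \<beta>" "a \<preceq> \<gamma>" "\<beta> \<preceq> b"
    using split_edge[OF w regions(3) a b c'] by blast
  have "a \<preceq> x"
  proof (cases "a = x")
    case True
    then show ?thesis using le_refl \<open>a \<in> X\<close> by simp
  next
    case False
    then obtain z where "Some x = Some z \<or> e = Some z" "a \<preceq> z" "z \<preceq> c"
      using sep_up[OF regions(2) _ _ ac] ab' c by auto
    then show ?thesis using gb nab le_trans by blast
  qed
  moreover have "x \<preceq> b"
  proof (cases "b = x")
    case True
    then show ?thesis using \<open>a \<preceq> x\<close> nab by simp
  next
    case False
    obtain y where y: "y \<preceq> b" "y \<notin> set_ttree (Node c L' R' Leaf)" using w by (auto simp: right_witness_def)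
    have "y \<notin> set_ttree L"
    proof -
      have "a \<in> set_ttree (Node x L R N)" "b \<in> set_ttree (Node x L R N)" using a b by auto
      from split_edge[OF w t this c] have "set_ttree (Node x L R N) \<subseteq> set_ttree R'" by blast
      then show ?thesis using y by auto
    qed
    then obtain z where "g = Some z \<or> Some x = Some z" "y \<preceq> z" "z \<preceq> b"
      using sep_down[OF regions(1) _ _ y(1)] ab' False by auto
    then show ?thesis using gb nab le_trans by blast
  qed
  ultimately show False using nab le_trans by blast
qed

text \<open>Once a \<le> x \<le> b' is known, (a, b) is not below the left side, so it is cut at
  \<open>x\<close> and \<open>k\<close> holds. Then (a', b') cannot be cut at \<open>x\<close>, as
  this would mean a' \<le> x \<le> b'. It lies below the right side together with its apex, and
  \<open>x\<close>, the left end of that side, serves as the \<open>\<gamma>\<close> of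
  \<open>shortcutI\<close>.\<close>

lemma crossing_right:
  assumes t: "region g e (Node x L R N)" and ab: "right_pair a b" and a'b': "right_pair a' b'" and ab': "a \<preceq> b'"
    and a: "a \<in> insert x (set_ttree L)" and b': "b' \<in> insert x (set_ttree R)"
    and b: "b \<in> set_ttree L \<and> a \<in> set_ttree L \<or> b \<in> insert x (set_ttree R) \<and> (a \<preceq> x) = k"
    and a': "a' \<in> set_ttree R \<and> b' \<in> set_ttree R \<or> a' \<in> insert x (set_ttree L) \<and> (a' \<preceq> x) = k"
  shows "shortcut (a, b) (a', b')"
proof -
  obtain g1 e1 c1 L1 R1 where w1: "right_witness a b g1 e1 c1 L1 R1" using ab by (auto simp: right_pair_def)
  obtain g2 e2 c2 L2 R2 where w2: "right_witness a' b' g2 e2 c2 L2 R2" using a'b' by (auto simp: right_pair_def)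
  have d: "distinct_tree (Node x L R N)" using regions_dist[OF t distinct_tree] .
  have nab: "\<not> a \<preceq> b" "\<not> a' \<preceq> b'" using w1 w2 by (auto simp: right_witness_def)
  have regions: "region g (Some x) L" "region (Some x) e R" using regions_trans[OF _ t] by auto
  have ab_t: "a \<in> set_ttree (Node x L R N)" "b \<in> set_ttree (Node x L R N)" using a b by auto
  \<comment> \<open>If the comparability avoided \<open>x\<close>, then \<open>a\<close> would be
    below both outer ends. Its apex would therefore lie outside this tree, and
    \<open>split_edge\<close> would put the right end below \<open>b\<close>, giving a \<le>
    b.\<close>
  have axb: "a \<preceq> x \<and> x \<preceq> b'"
  proof (cases "a = x \<or> b' = x")
    case True
    then show ?thesis using ab' le_refl le_X by blast
  next
    case False
    then have aL: "a \<in> set_ttree L" and bR: "b' \<in> set_ttree R" using a b' by auto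
    then have "a \<notin> set_ttree R" "b' \<notin> set_ttree L" using d by auto
    obtain z where z: "g = Some z \<or> Some x = Some z" "a \<preceq> z" "z \<preceq> b'"
      using sep_up[OF regions(1) aL \<open>b' \<notin> set_ttree L\<close> ab'] by blast
    obtain z' where z': "Some x = Some z' \<or> e = Some z'" "a \<preceq> z'" "z' \<preceq> b'"
      using sep_down[OF regions(2) bR \<open>a \<notin> set_ttree R\<close> ab'] by blast
    show ?thesis
    proof (rule ccontr)
      assume "\<not> ?thesis"
      then have gz: "g = Some z" and ez: "e = Some z'" using z z' by auto
      have c1: "c1 \<notin> set_ttree (Node x L R N)"
      proof
        assume c1: "c1 \<in> set_ttree (Node x L R N)"
        have "region g1 e1 (Node c1 L1 R1 Leaf)" using w1 by (simp add: right_witness_def)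
        from regions_set[OF node_in[OF t this c1]] have "z \<in> set_ttree (Node x L R N)"
          using w1 z(2) unfolding right_witness_def by blast
        then show False using region_ends[OF t] gz by blast
      qed
      have "z' \<preceq> b" using split_edge[OF w1 t ab_t c1] ez by auto
      then show False using z'(2) nab le_trans by blast
    qed
  qed
  have bL: "b \<notin> set_ttree L"
  proof
    assume bL: "b \<in> set_ttree L"
    then have aL: "a \<in> set_ttree L" using b d by auto
    have "c1 \<notin> set_ttree L"
    proof
      assume c1: "c1 \<in> set_ttree L"
      have "region g1 e1 (Node c1 L1 R1 Leaf)" using w1 by (simp add: right_witness_def)
      from regions_set[OF node_in[OF regions(1) this c1]] have "x \<in> set_ttree L"
        using w1 axb unfolding right_witness_def by blast
      then show False using d by simp
    qed
    then have "x \<preceq> b" using split_edge[OF w1 regions(1) aL bL] by auto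
    then show False using axb nab le_trans by blast
  qed
  then have k using b axb by auto
  then have a'R: "a' \<in> set_ttree R" "b' \<in> set_ttree R" using a' axb nab le_trans by blast+
  have "c2 \<in> set_ttree R"
  proof (rule ccontr)
    assume "c2 \<notin> set_ttree R"
    then have "a' \<preceq> x" using split_edge[OF w2 regions(2) a'R] by auto
    then show False using axb nab le_trans by blast
  qed
  moreover have "a \<notin> set_ttree R" using a d by auto
  ultimately show ?thesis using shortcutI[OF regions(2) _ _ w2] axb by blast
qed

definition in_class :: "'a ttree \<Rightarrow> bool \<Rightarrow> 'a \<times> 'a \<Rightarrow> bool" where
  "in_class t k i \<longleftrightarrow> fst i \<in> set_ttree t \<and> snd i \<in> set_ttree t \<and> cut_class t (fst i) (snd i) = k"

text \<open>Along steps that are not shortcuts, the place where the two elements of a pair are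
  separated never moves upward in a left-to-right order of the places. A cycle thus stays at one
  place, which must be a subtree, and the induction hypothesis applies.\<close>

lemma acyclic_good:
  "region g e t \<Longrightarrow> acyclic {(i, j) \<in> alternating. \<not> shortcut i j \<and> in_class t k i \<and> in_class t k j}"
proof (induction t arbitrary: g e)
  case Leaf
  have "{(i, j) \<in> alternating. \<not> shortcut i j \<and> in_class Leaf k i \<and> in_class Leaf k j} = {}" by (auto simp: in_class_def)
  then show ?case by (simp only:) (simp add: acyclic_def)
next
  case (Node x L R N)
  note t = Node.prems
  have d: "distinct_tree (Node x L R N)" using regions_dist[OF t distinct_tree] .
  have regions: "region g (Some x) L" "region (Some x) e R" "region g e N" "region g e (Node x L R Leaf)"
    using regions_trans[OF _ t] by auto
  let ?S = "{(i, j) \<in> alternating. \<not> shortcut i j \<and> in_class (Node x L R N) k i \<and> in_class (Node x L R N) k j}"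
  let ?sub = "set_ttree (Node x L R Leaf)"
  \<comment> \<open>From level 0 on, the places are L, cut at \<open>x\<close>, R, cut before N, N
    if \<open>k\<close> holds, and N, cut before N, L, cut at \<open>x\<close>, R otherwise. Within
    one class, all pairs cut between the front triangle and N have the same direction; in the first
    class it is b that lies in N, in the second a. This is why N changes its place.\<close>
  define f :: "'a \<times> 'a \<Rightarrow> nat" where "f = (\<lambda>(a, b).
    if a \<in> set_ttree N \<and> b \<in> set_ttree N then if k then 4 else 0
    else if a \<in> set_ttree N \<or> b \<in> set_ttree N then if k then 3 else 1
    else if a \<in> set_ttree L \<and> b \<in> set_ttree L then if k then 0 else 2
    else if a \<in> set_ttree R \<and> b \<in> set_ttree R then if k then 2 else 4
    else if k then 1 else 3)"
  have same_side: "a \<in> set_ttree N \<longleftrightarrow> b' \<in> set_ttree N" if S: "((a, b), (a', b')) \<in> ?S" for a b a' b'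
  proof (rule ccontr)
    assume neq: "(a \<in> set_ttree N) \<noteq> (b' \<in> set_ttree N)"
    have in_t: "a \<in> set_ttree (Node x L R N)" "b \<in> set_ttree (Node x L R N)" "a' \<in> set_ttree (Node x L R N)"
      "b' \<in> set_ttree (Node x L R N)" and ab: "right_pair a b" "right_pair a' b'" "a \<preceq> b'" and nb: "\<not> shortcut (a, b) (a', b')"
      using S by (auto simp: in_class_def alternating_def)
    obtain g' e' c L' R' where w: "right_witness a' b' g' e' c L' R'" using ab by (auto simp: right_pair_def)
    have b'R: "b' \<in> set_ttree R'" using w by (simp add: right_witness_def)
    note cases = node_cases[OF t w]
    note shortcut = crossing_bad[OF t in_t(1,2) ab(1) w in_t(3,4) ab(3)]
    show False
    proof (cases "b' \<in> set_ttree N")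
      case True
      then have "c \<in> set_ttree N" if "c \<in> set_ttree (Node x L R N)" using cases[OF that] d b'R by auto
      then show False using shortcut[OF regions(3)] neq True nb by auto
    next
      case False
      then have "b' \<in> ?sub" "a \<notin> ?sub" using in_t neq d by auto
      moreover have "c \<in> ?sub" if "c \<in> set_ttree (Node x L R N)" using cases[OF that] False by auto
      ultimately show False using shortcut[OF regions(4)] nb by auto
    qed
  qed
  have types: "a \<in> set_ttree N \<and> b \<in> set_ttree N \<and> cut_class N a b = k \<and> f (a, b) = (if k then 4 else 0) \<or>
      (a \<in> set_ttree N) = (\<not> k) \<and> (b \<in> set_ttree N) = k \<and> f (a, b) = (if k then 3 else 1) \<or>
      a \<notin> set_ttree N \<and> b \<notin> set_ttree N \<and> a \<in> set_ttree L \<and> b \<in> set_ttree L \<and> cut_class L a b = k \<and>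
        f (a, b) = (if k then 0 else 2) \<or>
      a \<notin> set_ttree N \<and> b \<notin> set_ttree N \<and> a \<in> set_ttree R \<and> b \<in> set_ttree R \<and> cut_class R a b = k \<and>
        f (a, b) = (if k then 2 else 4) \<or>
      a \<notin> set_ttree N \<and> b \<notin> set_ttree N \<and> a \<in> insert x (set_ttree L) \<and> b \<in> insert x (set_ttree R) \<and>
        (a \<preceq> x) = k \<and> f (a, b) = (if k then 1 else 3)"
    if "right_pair a b" and i: "in_class (Node x L R N) k (a, b)" for a b
  proof -
    have in_t: "a \<in> set_ttree (Node x L R N)" "b \<in> set_ttree (Node x L R N)" and c: "cut_class (Node x L R N) a b = k"
      using i by (auto simp: in_class_def)
    consider "a \<in> set_ttree N" "b \<in> set_ttree N" | "(a \<in> set_ttree N) \<noteq> (b \<in> set_ttree N)"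
      | "a \<in> ?sub" "b \<in> ?sub" "a \<notin> set_ttree N" "b \<notin> set_ttree N" using in_t by auto
    then show ?thesis
    proof cases
      case 1
      then show ?thesis using c by (auto simp: f_def)
    next
      case 2
      then have "\<not> (a \<in> set_ttree L \<and> b \<in> set_ttree L)" "\<not> (a \<in> set_ttree R \<and> b \<in> set_ttree R)" using d by auto
      then show ?thesis using 2 c by (auto simp: f_def)
    next
      case 3
      then have "\<not> (a \<in> set_ttree L \<and> b \<in> set_ttree R \<and> (a \<in> set_ttree R \<or> b \<in> set_ttree L))"
        "x \<notin> set_ttree L" "x \<notin> set_ttree R" "set_ttree L \<inter> set_ttree R = {}" using d by auto
      then show ?thesis using right_pair_cases[OF t that(1) 3(1,2)] 3(3,4) c
        by (elim disjE) (simp_all add: f_def, auto)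
    qed
  qed
  have cross: "\<not> (a \<in> insert x (set_ttree L) \<and> b' \<in> insert x (set_ttree R))"
    if S: "((a, b), (a', b')) \<in> ?S" and i: "f (a, b) \<in> (if k then {0, 1} else {2, 3})"
      and j: "f (a', b') \<in> (if k then {1, 2} else {3, 4})" for a b a' b'
  proof
    assume ab: "a \<in> insert x (set_ttree L) \<and> b' \<in> insert x (set_ttree R)"
    have S': "right_pair a b" "right_pair a' b'" "a \<preceq> b'" "\<not> shortcut (a, b) (a', b')"
      "in_class (Node x L R N) k (a, b)" "in_class (Node x L R N) k (a', b')"
      using S by (auto simp: alternating_def)
    have "b \<in> set_ttree L \<and> a \<in> set_ttree L \<or> b \<in> insert x (set_ttree R) \<and> (a \<preceq> x) = k"
      using types[OF S'(1,5)] i by (cases k) auto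
    moreover have "a' \<in> set_ttree R \<and> b' \<in> set_ttree R \<or> a' \<in> insert x (set_ttree L) \<and> (a' \<preceq> x) = k"
      using types[OF S'(2,6)] j by (cases k) auto
    ultimately show False using crossing_right[OF t S'(1-3)] ab S'(4) by blast
  qed
  show ?case
  proof (rule acyclic_levels[where f = f])
    fix i j assume S: "(i, j) \<in> ?S"
    obtain a b a' b' where ij: "i = (a, b)" "j = (a', b')" by (cases i, cases j)
    have S': "right_pair a b" "right_pair a' b'" "in_class (Node x L R N) k (a, b)" "in_class (Node x L R N) k (a', b')"
      using S by (auto simp: alternating_def ij)
    show "f j \<le> f i"
      using types[OF S'(1,3)] types[OF S'(2,4)] same_side[OF S[unfolded ij]] cross[OF S[unfolded ij]]
      unfolding ij by (elim disjE conjE) (simp_all split: if_splits)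
  next
    fix l
    let ?G = "\<lambda>t. {(i, j) \<in> alternating. \<not> shortcut i j \<and> in_class t k i \<and> in_class t k j}"
    let ?A = "{(i, j) \<in> ?S. f i = l \<and> f j = l}"
    have "?A \<subseteq> (if l = (if k then 4 else 0) then ?G N else if l = (if k then 0 else 2) then ?G L else ?G R)"
    proof (rule subsetI)
      fix p assume p: "p \<in> ?A"
      obtain a b a' b' where p_eq: "p = ((a, b), (a', b'))" by (metis surj_pair)
      have S: "((a, b), (a', b')) \<in> ?S" and l: "f (a, b) = l" "f (a', b') = l"
        using p by (auto simp: p_eq)
      have S': "((a, b), (a', b')) \<in> alternating" "right_pair a b" "right_pair a' b'" "\<not> shortcut (a, b) (a', b')"
        "in_class (Node x L R N) k (a, b)" "in_class (Node x L R N) k (a', b')"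
        using S by (auto simp: alternating_def)
      have ff: "f (a', b') = f (a, b)" using l by simp
      \<comment> \<open>Levels 1 and 3 consist of the pairs cut at this node. No step without
        shortcut joins two pairs of the same such level, so only the levels of the three subtrees
        remain.\<close>
      have "f (a, b) \<noteq> 1 \<and> f (a, b) \<noteq> 3"
      proof -
        have N: "(a \<in> set_ttree N) = (\<not> k)" if "f (a, b) = (if k then 3 else 1)"
          using types[OF S'(2,5)] that by (cases k) auto
        have N': "(b' \<in> set_ttree N) = k" if "f (a', b') = (if k then 3 else 1)"
          using types[OF S'(3,6)] that by (cases k) auto
        have J: "a \<in> insert x (set_ttree L)" if "f (a, b) = (if k then 1 else 3)"
          using types[OF S'(2,5)] that by (cases k) auto
        have J': "b' \<in> insert x (set_ttree R)" if "f (a', b') = (if k then 1 else 3)"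
          using types[OF S'(3,6)] that by (cases k) auto
        have "f (a, b) \<noteq> (if k then 3 else 1)" using N N' same_side[OF S] ff by auto
        moreover have "f (a, b) \<noteq> (if k then 1 else 3)"
        proof
          assume f: "f (a, b) = (if k then 1 else 3)"
          show False using cross[OF S] J[OF f] J'[OF f[folded ff]] f ff by (cases k) auto
        qed
        ultimately show ?thesis by (cases k) auto
      qed
      then have l13: "l \<noteq> 1" "l \<noteq> 3" using l by auto
      define s where "s = (if l = (if k then 4 else 0) then N else if l = (if k then 0 else 2) then L else R)"
      have in_class: "in_class s k (a, b)"
        using types[OF S'(2,5)] l13 unfolding l(1) s_def by (cases k) (auto simp: in_class_def)
      have inn': "in_class s k (a', b')"
        using types[OF S'(3,6)] l13 unfolding l(2) s_def by (cases k) (auto simp: in_class_def)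
      show "p \<in> (if l = (if k then 4 else 0) then ?G N else if l = (if k then 0 else 2) then ?G L else ?G R)"
        using in_class inn' S'(1,4) unfolding p_eq s_def by (simp split: if_splits)
    qed
    moreover have "acyclic (?G N)" "acyclic (?G L)" "acyclic (?G R)"
      using Node.IH regions by blast+
    ultimately show "acyclic ?A" by (elim acyclic_subset[rotated]) (simp split: if_split)
  qed
qed

theorem acyclic_alt: "acyclic {(i, j) \<in> alternating. cut_class t0 (fst i) (snd i) = k \<and> cut_class t0 (fst j) (snd j) = k}"
proof (rule acyclic_shortcut[where B = shortcut])
  fix i show "(i, i) \<notin> {(i, j) \<in> alternating. cut_class t0 (fst i) (snd i) = k \<and> cut_class t0 (fst j) (snd j) = k}"
    by (auto simp: alternating_def right_pair_def right_witness_def)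
next
  have "right_pair a b \<Longrightarrow> a \<in> X \<and> b \<in> X" for a b
    unfolding right_pair_def right_witness_def using le_X region_X by fastforce
  then have "{(i, j). (i, j) \<in> {(i, j) \<in> alternating. cut_class t0 (fst i) (snd i) = k \<and> cut_class t0 (fst j) (snd j) = k} \<and> \<not> shortcut i j}
      \<subseteq> {(i, j) \<in> alternating. \<not> shortcut i j \<and> in_class t0 k i \<and> in_class t0 k j}"
    by (auto simp: in_class_def alternating_def set_t0)
  moreover have "acyclic {(i, j) \<in> alternating. \<not> shortcut i j \<and> in_class t0 k i \<and> in_class t0 k j}"
    by (rule acyclic_good[OF regions_refl])
  ultimately show "acyclic {(i, j). (i, j) \<in> {(i, j) \<in> alternating. cut_class t0 (fst i) (snd i) = k \<and> cut_class t0 (fst j) (snd j) = k} \<and> \<not> shortcut i j}"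
    by (rule acyclic_subset[rotated])
next
  fix i j
  let ?R = "{(i, j) \<in> alternating. cut_class t0 (fst i) (snd i) = k \<and> cut_class t0 (fst j) (snd j) = k}"
  assume ij: "(i, j) \<in> ?R" "shortcut i j"
  then obtain F where F: "j \<in> F" "i \<notin> F"
    "\<And>p q. (p, q) \<in> alternating \<Longrightarrow> p \<in> F \<Longrightarrow> q \<notin> F \<Longrightarrow> fst i \<preceq> snd q"
    unfolding shortcut_def by blast
  have "(i, q) \<in> ?R" if "(p, q) \<in> ?R" "p \<in> F" "q \<notin> F" for p q
    using F(3)[of p q] that ij(1) by (auto simp: alternating_def)
  then show "\<exists>F. j \<in> F \<and> i \<notin> F \<and> (\<forall>p q. (p, q) \<in> ?R \<longrightarrow> p \<in> F \<longrightarrow> q \<notin> F \<longrightarrow> (i, q) \<in> ?R)"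
    using F(1,2) by blast
qed

end

section \<open>Covering incomparable pairs by reversible sets\<close>

lemma finite_acyclic_linear_order:
  assumes "finite X" "acyclic P"
  shows "\<exists>L. linear_order_on X L \<and> P \<inter> X \<times> X \<subseteq> L"
  using assms(1)
proof (induction X rule: finite_psubset_induct)
  case (psubset X)
  show ?case
  proof (cases "X = {}")
    case True
    then show ?thesis by (auto simp: order_on_defs refl_on_def total_on_def)
  next
    case False
    have "wf (P \<inter> X \<times> X)"
      using psubset.hyps assms(2) by (intro finite_acyclic_wf) (auto intro: acyclic_subset)
    then obtain m where m: "m \<in> X" "\<And>y. (y, m) \<in> P \<inter> X \<times> X \<Longrightarrow> y \<notin> X"
      using False wfE_min[of "P \<inter> X \<times> X" _ X] by (metis all_not_in_conv)
    obtain L where L: "linear_order_on (X - {m}) L" "P \<inter> (X - {m}) \<times> (X - {m}) \<subseteq> L"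
      using psubset.IH[of "X - {m}"] m(1) by blast
    then have Lsub: "L \<subseteq> (X - {m}) \<times> (X - {m})" by (simp add: order_on_defs)
    have "linear_order_on X (L \<union> {m} \<times> X)"
      using L(1) Lsub m(1) unfolding order_on_defs refl_on_def trans_def antisym_def total_on_def
      by (intro conjI; blast)
    moreover have "P \<inter> X \<times> X \<subseteq> L \<union> {m} \<times> X" using L(2) m by blast
    ultimately show ?thesis by blast
  qed
qed

definition reversible :: "'a set \<Rightarrow> 'a rel \<Rightarrow> ('a \<times> 'a) set \<Rightarrow> bool" where
  "reversible X r I \<longleftrightarrow> (\<exists>L. linear_order_on X L \<and> r \<subseteq> L \<and> (\<forall>(a, b) \<in> I. (b, a) \<in> L))"

text \<open>This is the alternating cycle criterion. The order together with the reversed pairs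
  extends to a linear order unless it has a closed walk, and contracting the order steps of such a
  walk leaves a closed walk of alternating pairs.\<close>

lemma reversibleI:
  assumes fin: "finite X" and po: "partial_order_on X r" and I: "I \<subseteq> X \<times> X"
    and acyc: "acyclic {((a, b), (a', b')). (a, b) \<in> I \<and> (a', b') \<in> I \<and> (a, b') \<in> r}"
  shows "reversible X r I"
proof -
  let ?R = "{((a, b), (a', b')). (a, b) \<in> I \<and> (a', b') \<in> I \<and> (a, b') \<in> r}"
  let ?Q = "(r - Id) \<union> I\<inverse>"
  have r: "r \<subseteq> X \<times> X" "refl_on X r" "trans r" "antisym r"
    using po by (auto simp: order_on_defs)
  have refl: "(x, x) \<in> r" if "x \<in> X" for x using r(2) that by (auto simp: refl_on_def)
  \<comment> \<open>Of a walk that uses reversed pairs, only the first and the last of them and the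
    alternating chain between them are recorded. A walk of strict order steps alone stays strict by
    antisymmetry.\<close>
  have path: "(x, y) \<in> r - Id \<or> (\<exists>a b a' b'. (a, b) \<in> I \<and> (a', b') \<in> I \<and> ((a, b), (a', b')) \<in> ?R\<^sup>* \<and>
      (x, b) \<in> r \<and> (a', y) \<in> r)" if "(x, y) \<in> ?Q\<^sup>+" for x y
    using that
  proof (induction rule: trancl_induct)
    case (base y)
    then consider "(x, y) \<in> r - Id" | "(y, x) \<in> I" by auto
    then show ?case
    proof cases
      case 2
      then have "(x, x) \<in> r" "(y, y) \<in> r" using I refl by auto
      then show ?thesis using 2 by blast
    qed simp
  next
    case (step y z)
    from step(2) consider "(y, z) \<in> r - Id" | "(z, y) \<in> I" by auto
    then show ?case
    proof cases
      case 1
      from step.IH show ?thesis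
      proof (elim disjE exE conjE)
        assume xy: "(x, y) \<in> r - Id"
        then have "(x, z) \<in> r" "x \<noteq> z" using 1 r(3,4) by (auto dest: transD antisymD)
        then show ?thesis by simp
      next
        fix a b a' b'
        assume "(a, b) \<in> I" "(a', b') \<in> I" "((a, b), (a', b')) \<in> ?R\<^sup>*" "(x, b) \<in> r" "(a', y) \<in> r"
        moreover from this have "(a', z) \<in> r" using 1 transD[OF r(3)] by blast
        ultimately show ?thesis by blast
      qed
    next
      case 2
      then have zz: "(z, z) \<in> r" using I refl by auto
      from step.IH show ?thesis
      proof (elim disjE exE conjE)
        assume "(x, y) \<in> r - Id"
        then show ?thesis using 2 zz by blast
      next
        fix a b a' b'
        assume ab: "(a, b) \<in> I" "(a', b') \<in> I" "((a, b), (a', b')) \<in> ?R\<^sup>*" "(x, b) \<in> r" "(a', y) \<in> r"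
        then have "((a', b'), (z, y)) \<in> ?R" using 2 by auto
        then have "((a, b), (z, y)) \<in> ?R\<^sup>*" using ab(3) by (rule rtrancl_into_rtrancl[rotated])
        then show ?thesis using ab(1,4) 2 zz by blast
      qed
    qed
  qed
  have "acyclic ?Q"
  proof (rule acyclicI, intro allI notI)
    fix x assume "(x, x) \<in> ?Q\<^sup>+"
    from path[OF this] obtain a b a' b' where ab: "(a, b) \<in> I" "(a', b') \<in> I"
      "((a, b), (a', b')) \<in> ?R\<^sup>*" "(x, b) \<in> r" "(a', x) \<in> r" by blast
    have "(a', b) \<in> r" using ab(4,5) transD[OF r(3)] by blast
    then have "((a', b'), (a, b)) \<in> ?R" using ab by auto
    then have "((a', b'), (a', b')) \<in> ?R\<^sup>+" using ab(3) by (rule rtrancl_into_trancl2)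
    then show False using acyc by (simp only: acyclic_def)
  qed
  then obtain L where L: "linear_order_on X L" "?Q \<inter> X \<times> X \<subseteq> L"
    using finite_acyclic_linear_order[OF fin] by blast
  have "(x, x) \<in> L" if "x \<in> X" for x
    using L(1) that by (auto simp: order_on_defs refl_on_def)
  then have "r \<subseteq> L" using L(2) r(1) by blast
  moreover have "\<forall>(a, b) \<in> I. (b, a) \<in> L" using L(2) I by auto
  ultimately show ?thesis using L(1) unfolding reversible_def by blast
qed

lemma reversible_converse:
  assumes "reversible X (r\<inverse>) I"
  shows "reversible X r (I\<inverse>)"
proof -
  obtain L where L: "linear_order_on X L" "r\<inverse> \<subseteq> L" "\<forall>(a, b) \<in> I. (b, a) \<in> L"
    using assms by (auto simp: reversible_def)
  have "linear_order_on X (L\<inverse>)" using L(1)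
    by (auto simp: order_on_defs refl_on_def trans_def antisym_def total_on_def)
  moreover have "r \<subseteq> L\<inverse>" using L(2) by auto
  ultimately show ?thesis using L(3) unfolding reversible_def by blast
qed

definition covered :: "'a set \<Rightarrow> 'a rel \<Rightarrow> nat \<Rightarrow> ('a \<times> 'a) set \<Rightarrow> bool" where
  "covered X r n A \<longleftrightarrow> (\<exists>I. (\<forall>k<n. reversible X r (I k)) \<and> A \<subseteq> (\<Union>k<n. I k))"

lemma covered_Un:
  assumes "covered X r m A" "covered X r n B"
  shows "covered X r (m + n) (A \<union> B)"
proof -
  obtain I J where I: "\<forall>k<m. reversible X r (I k)" "A \<subseteq> (\<Union>k<m. I k)"
    and J: "\<forall>k<n. reversible X r (J k)" "B \<subseteq> (\<Union>k<n. J k)"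
    using assms by (auto simp: covered_def)
  define K where "K = (\<lambda>k. if k < m then I k else J (k - m))"
  have "reversible X r (K k)" if "k < m + n" for k using I J that by (auto simp: K_def)
  moreover have "A \<subseteq> (\<Union>k<m + n. K k)"
  proof
    fix p assume "p \<in> A"
    then obtain k where "k < m" "p \<in> I k" using I(2) by auto
    then have "k < m + n" "p \<in> K k" by (auto simp: K_def)
    then show "p \<in> (\<Union>k<m + n. K k)" by blast
  qed
  moreover have "B \<subseteq> (\<Union>k<m + n. K k)"
  proof
    fix p assume "p \<in> B"
    then obtain k where "k < n" "p \<in> J k" using J(2) by auto
    then have "k + m < m + n" "p \<in> K (k + m)" by (auto simp: K_def)
    then show "p \<in> (\<Union>k<m + n. K k)" by blast
  qed
  ultimately show ?thesis unfolding covered_def by (intro exI[of _ K]) blast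
qed

lemma covered_mono: "covered X r n A \<Longrightarrow> B \<subseteq> A \<Longrightarrow> covered X r n B"
  unfolding covered_def by blast

lemma covered_2I:
  assumes "\<And>k :: bool. reversible X r (I k)" and "A \<subseteq> I True \<union> I False"
  shows "covered X r 2 A"
proof -
  have "A \<subseteq> (\<Union>k<2. I (k = (0 :: nat)))"
  proof
    fix p assume "p \<in> A"
    then have "p \<in> I (0 = (0 :: nat)) \<or> p \<in> I (1 = (0 :: nat))" using assms(2) by auto
    moreover have "(0 :: nat) < 2" "(1 :: nat) < 2" by simp_all
    ultimately show "p \<in> (\<Union>k<2. I (k = (0 :: nat)))" by blast
  qed
  then show ?thesis unfolding covered_def using assms(1) by (intro exI[of _ "\<lambda>k. I (k = 0)"]) simp
qed

lemma covered_converse: "covered X (r\<inverse>) n A \<Longrightarrow> covered X r n (A\<inverse>)"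
proof -
  assume "covered X (r\<inverse>) n A"
  then obtain I where I: "\<And>k. k < n \<Longrightarrow> reversible X (r\<inverse>) (I k)" "A \<subseteq> (\<Union>k<n. I k)"
    by (auto simp: covered_def)
  have "reversible X r ((I k)\<inverse>)" if "k < n" for k using reversible_converse[OF I(1)[OF that]] .
  moreover have "A\<inverse> \<subseteq> (\<Union>k<n. (I k)\<inverse>)" using I(2) by auto
  ultimately show ?thesis unfolding covered_def by (intro exI[of _ "\<lambda>k. (I k)\<inverse>"]) simp
qed

lemma finite_ttree: "finite (set_ttree t)" by (induction t) auto

context tree_poset begin

lemma finite_carrier: "finite X" using set_t0 by (metis finite_ttree)

lemma right_pair_X: "right_pair a b \<Longrightarrow> a \<in> X \<and> b \<in> X"
  unfolding right_pair_def right_witness_def using le_X region_X by fastforce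

lemma covered_plus: "covered X r 2 {(a, b). right_pair a b}"
proof (rule covered_2I[where I = "\<lambda>k. {(a, b). right_pair a b \<and> cut_class t0 a b = k}"])
  show "reversible X r {(a, b). right_pair a b \<and> cut_class t0 a b = k}" for k
  proof (rule reversibleI[OF finite_carrier po])
    show "{(a, b). right_pair a b \<and> cut_class t0 a b = k} \<subseteq> X \<times> X" using right_pair_X by blast
    show "acyclic {((a, b), (a', b')). (a, b) \<in> {(a, b). right_pair a b \<and> cut_class t0 a b = k} \<and>
        (a', b') \<in> {(a, b). right_pair a b \<and> cut_class t0 a b = k} \<and> a \<preceq> b'}"
      using acyclic_alt[of k] by (rule acyclic_subset) (auto simp: alternating_def)
  qed
qed auto

text \<open>Descend towards \<open>a\<close>. As long as neither the ends nor the apex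
  \<open>x\<close> is above \<open>a\<close>, the up-set of \<open>a\<close> cannot leave the child
  that contains \<open>a\<close>. The first apex above \<open>a\<close> is the one sought.\<close>

lemma ex_top:
  assumes "region g e t" "a \<in> set_ttree t" "\<And>z. a \<preceq> z \<Longrightarrow> z \<in> set_ttree t"
  shows "\<exists>g e c L R. region g e (Node c L R Leaf) \<and> a \<preceq> c \<and> (\<forall>z. a \<preceq> z \<longrightarrow> z \<in> set_ttree (Node c L R Leaf))"
  using assms
proof (induction t arbitrary: g e)
  case Leaf
  then show ?case by simp
next
  case (Node x L R N)
  have regions: "region g (Some x) L" "region (Some x) e R" "region g e N" "region g e (Node x L R Leaf)"
    using regions_trans[OF _ Node.prems(1)] by auto
  have no_end: "\<not> a \<preceq> w" if "g = Some w \<or> e = Some w" for w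
    using region_ends[OF Node.prems(1) that] Node.prems(3) by blast
  have aa: "a \<preceq> a" using region_X[OF Node.prems(1,2)] le_refl by blast
  have stay: "z \<in> set_ttree s" if "region g' e' s" "a \<in> set_ttree s" "a \<preceq> z"
    "\<And>w. g' = Some w \<or> e' = Some w \<Longrightarrow> \<not> a \<preceq> w" for z s g' e'
    using sep_up[OF that(1,2) _ that(3)] that(4) by blast
  show ?case
  proof (cases "a \<preceq> x")
    case True
    have "a \<in> set_ttree (Node x L R Leaf)"
    proof (rule ccontr)
      assume "a \<notin> set_ttree (Node x L R Leaf)"
      then have "a \<in> set_ttree N" using Node.prems(2) by auto
      then have "x \<in> set_ttree N" using stay[OF regions(3) _ True] no_end by blast
      then show False using regions_dist[OF Node.prems(1) distinct_tree] by simp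
    qed
    then have "\<forall>z. a \<preceq> z \<longrightarrow> z \<in> set_ttree (Node x L R Leaf)" using stay[OF regions(4)] no_end by blast
    then show ?thesis using regions(4) True by blast
  next
    case False
    then have region_ends: "\<not> a \<preceq> w" if "g = Some w \<or> Some x = Some w \<or> e = Some w" for w
      using no_end that by auto
    have "a \<noteq> x" using False aa by blast
    then consider "a \<in> set_ttree L" | "a \<in> set_ttree R" | "a \<in> set_ttree N" using Node.prems(2) by auto
    then show ?thesis
    proof cases
      case 1
      have "z \<in> set_ttree L" if "a \<preceq> z" for z using stay[OF regions(1) 1 that] region_ends by blast
      then show ?thesis by (rule Node.IH(1)[OF regions(1) 1])
    next
      case 2
      have "z \<in> set_ttree R" if "a \<preceq> z" for z using stay[OF regions(2) 2 that] region_ends by blast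
      then show ?thesis by (rule Node.IH(2)[OF regions(2) 2])
    next
      case 3
      have "z \<in> set_ttree N" if "a \<preceq> z" for z using stay[OF regions(3) 3 that] region_ends by blast
      then show ?thesis by (rule Node.IH(3)[OF regions(3) 3])
    qed
  qed
qed

end

text \<open>Positions in two depth-first orders; they visit the children in opposite directions.\<close>

primrec dfs_num :: "bool \<Rightarrow> 'a ttree \<Rightarrow> 'a \<Rightarrow> nat" where
  "dfs_num s Leaf v = 0"
| "dfs_num s (Node x L R N) v = (if s
     then if v = x then 0 else if v \<in> set_ttree L then Suc (dfs_num s L v)
       else if v \<in> set_ttree R then Suc (card (set_ttree L) + dfs_num s R v)
       else Suc (card (set_ttree L) + card (set_ttree R) + dfs_num s N v)
     else if v \<in> set_ttree N then dfs_num s N v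
       else if v = x then card (set_ttree N)
       else if v \<in> set_ttree R then Suc (card (set_ttree N) + dfs_num s R v)
       else Suc (card (set_ttree N) + card (set_ttree R) + dfs_num s L v))"

lemma dfs_num_less: "distinct_tree t \<Longrightarrow> v \<in> set_ttree t \<Longrightarrow> dfs_num s t v < card (set_ttree t)"
proof (induction t)
  case (Node x L R N)
  have "card (set_ttree (Node x L R N)) = Suc (card (set_ttree L) + card (set_ttree R) + card (set_ttree N))"
    using Node.prems(1) by (simp add: card_Un_disjoint finite_ttree Int_Un_distrib Int_Un_distrib2)
  moreover have "v \<in> set_ttree L \<Longrightarrow> dfs_num s L v < card (set_ttree L)" "v \<in> set_ttree R \<Longrightarrow> dfs_num s R v < card (set_ttree R)"
    "v \<in> set_ttree N \<Longrightarrow> dfs_num s N v < card (set_ttree N)"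
    using Node.IH Node.prems(1) by auto
  ultimately show ?case using Node.prems by auto
qed simp

text \<open>Both orders visit an apex before the two sides of its triangle; only \<open>N\<close>
  and the order of the sides change places.\<close>

lemma dfs_num_desc:
  "distinct_tree t \<Longrightarrow> (g', e', Node c L R Leaf) \<in> regions g e t \<Longrightarrow> v \<in> set_ttree L \<union> set_ttree R \<Longrightarrow> dfs_num s t c < dfs_num s t v"
proof (induction t arbitrary: g e)
  case (Node x L1 R1 N1)
  have IH: "(g', e', Node c L R Leaf) \<in> regions g (Some x) L1 \<Longrightarrow> dfs_num s L1 c < dfs_num s L1 v"
    "(g', e', Node c L R Leaf) \<in> regions (Some x) e R1 \<Longrightarrow> dfs_num s R1 c < dfs_num s R1 v"
    "(g', e', Node c L R Leaf) \<in> regions g e N1 \<Longrightarrow> dfs_num s N1 c < dfs_num s N1 v"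
    using Node by auto
  have sub: "(g', e', Node c L R Leaf) \<in> regions g (Some x) L1 \<Longrightarrow> c \<in> set_ttree L1 \<and> v \<in> set_ttree L1"
    "(g', e', Node c L R Leaf) \<in> regions (Some x) e R1 \<Longrightarrow> c \<in> set_ttree R1 \<and> v \<in> set_ttree R1"
    "(g', e', Node c L R Leaf) \<in> regions g e N1 \<Longrightarrow> c \<in> set_ttree N1 \<and> v \<in> set_ttree N1"
    using regions_set[of g' e' "Node c L R Leaf"] Node.prems(3) by fastforce+
  consider "c = x" "v \<in> set_ttree L1 \<union> set_ttree R1" | "(g', e', Node c L R Leaf) \<in> regions g (Some x) L1"
    | "(g', e', Node c L R Leaf) \<in> regions (Some x) e R1" | "(g', e', Node c L R Leaf) \<in> regions g e N1"
    using Node.prems(2,3) by auto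
  then show ?case
  proof cases
    case 1
    then show ?thesis using Node.prems(1) by auto
  next
    case 2
    then show ?thesis using Node.prems(1) IH(1)[OF 2] sub(1)[OF 2] by auto
  next
    case 3
    then show ?thesis using Node.prems(1) IH(2)[OF 3] sub(2)[OF 3] by auto
  next
    case 4
    then show ?thesis using Node.prems(1) IH(3)[OF 4] sub(3)[OF 4] by auto
  qed
qed simp

text \<open>Triangles are nested like a forest, an order of dimension at most two: disjoint parts
  occur in both relative orders, and a triangle that surrounds \<open>c\<close> has its apex before
  \<open>c\<close> in both.\<close>

lemma dfs_num_incomparable:
  "distinct_tree t \<Longrightarrow> (g', e', Node c L R Leaf) \<in> regions g e t \<Longrightarrow> v \<in> set_ttree t \<Longrightarrow> v \<notin> set_ttree (Node c L R Leaf) \<Longrightarrow>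
    dfs_num True t v < dfs_num True t c \<or> dfs_num False t v < dfs_num False t c"
proof (induction t arbitrary: g e)
  case (Node x L1 R1 N1)
  have d: "distinct_tree L1" "distinct_tree R1" "distinct_tree N1" using Node.prems(1) by auto
  note IH = Node.IH(1)[OF d(1), of g "Some x"] Node.IH(2)[OF d(2), of "Some x" e] Node.IH(3)[OF d(3), of g e]
  have sub: "(g', e', Node c L R Leaf) \<in> regions g (Some x) L1 \<Longrightarrow> c \<in> set_ttree L1"
    "(g', e', Node c L R Leaf) \<in> regions (Some x) e R1 \<Longrightarrow> c \<in> set_ttree R1"
    "(g', e', Node c L R Leaf) \<in> regions g e N1 \<Longrightarrow> c \<in> set_ttree N1"
    using regions_set[of g' e' "Node c L R Leaf"] by fastforce+
  have lt: "v \<in> set_ttree L1 \<Longrightarrow> dfs_num s L1 v < card (set_ttree L1)" "v \<in> set_ttree R1 \<Longrightarrow> dfs_num s R1 v < card (set_ttree R1)"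
    "v \<in> set_ttree N1 \<Longrightarrow> dfs_num s N1 v < card (set_ttree N1)" for s
    using dfs_num_less[OF d(1)] dfs_num_less[OF d(2)] dfs_num_less[OF d(3)] by auto
  have disj: "z \<in> set_ttree L1 \<Longrightarrow> z \<noteq> x \<and> z \<notin> set_ttree R1 \<and> z \<notin> set_ttree N1"
    "z \<in> set_ttree R1 \<Longrightarrow> z \<noteq> x \<and> z \<notin> set_ttree L1 \<and> z \<notin> set_ttree N1"
    "z \<in> set_ttree N1 \<Longrightarrow> z \<noteq> x \<and> z \<notin> set_ttree L1 \<and> z \<notin> set_ttree R1" for z
    using Node.prems(1) by auto
  have xs: "x \<notin> set_ttree L1" "x \<notin> set_ttree R1" "x \<notin> set_ttree N1" using Node.prems(1) by auto
  consider "c = x" "v \<in> set_ttree N1" | "(g', e', Node c L R Leaf) \<in> regions g (Some x) L1"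
    | "(g', e', Node c L R Leaf) \<in> regions (Some x) e R1" | "(g', e', Node c L R Leaf) \<in> regions g e N1"
    using Node.prems(2-4) by auto
  then have loc: "c = x \<and> v \<in> set_ttree N1 \<or>
    c \<in> set_ttree L1 \<and> (v \<in> set_ttree L1 \<longrightarrow> dfs_num True L1 v < dfs_num True L1 c \<or> dfs_num False L1 v < dfs_num False L1 c) \<or>
    c \<in> set_ttree R1 \<and> (v \<in> set_ttree R1 \<longrightarrow> dfs_num True R1 v < dfs_num True R1 c \<or> dfs_num False R1 v < dfs_num False R1 c) \<or>
    c \<in> set_ttree N1 \<and> (v \<in> set_ttree N1 \<longrightarrow> dfs_num True N1 v < dfs_num True N1 c \<or> dfs_num False N1 v < dfs_num False N1 c)"
    using IH Node.prems(4) sub by cases blast+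
  have "v = x \<or> v \<in> set_ttree L1 \<or> v \<in> set_ttree R1 \<or> v \<in> set_ttree N1" using Node.prems(3) by auto
  then show ?case
  proof (elim disjE)
    assume v: "v = x"
    then show ?thesis using loc xs disj[of c] by (elim disjE conjE) simp_all
  next
    assume v: "v \<in> set_ttree L1"
    then show ?thesis using loc xs lt(1)[OF v, of True] disj(1)[OF v] disj[of c] by (elim disjE conjE) simp_all
  next
    assume v: "v \<in> set_ttree R1"
    then show ?thesis using loc xs lt(2)[OF v, of False] lt(2)[OF v, of True] disj(2)[OF v] disj[of c]
      by (elim disjE conjE) simp_all
  next
    assume v: "v \<in> set_ttree N1"
    then show ?thesis using loc xs lt(3)[OF v, of False] disj(3)[OF v] disj[of c] by (elim disjE conjE) simp_all
  qed
qed simp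

section \<open>Mirror images and dual orders\<close>

primrec mirror :: "'a ttree \<Rightarrow> 'a ttree" where
  "mirror Leaf = Leaf"
| "mirror (Node x L R N) = Node x (mirror R) (mirror L) (mirror N)"

lemma set_mirror [simp]: "set_ttree (mirror t) = set_ttree t" by (induction t) auto

lemma distinct_mirror [simp]: "distinct_tree (mirror t) = distinct_tree t" by (induction t) auto

lemma regions_mirror: "regions e g (mirror t) = (\<lambda>(g', e', t'). (e', g', mirror t')) ` regions g e t"
  by (induction t arbitrary: g e) (auto simp: image_Un)

lemma tree_poset_mirror:
  assumes "tree_poset X r t"
  shows "tree_poset X r (mirror t)"
proof -
  interpret tree_poset X r t by fact
  have "separating r (mirror t)"
    using sep unfolding separating_def regions_mirror[of None None] by (auto simp: Un_commute)
  then show ?thesis using po distinct_tree set_t0 by unfold_locales auto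
qed

lemma tree_poset_converse:
  assumes "tree_poset X r t"
  shows "tree_poset X (r\<inverse>) t"
proof -
  interpret tree_poset X r t by fact
  have "separating (r\<inverse>) t"
    unfolding separating_def
  proof (clarsimp, intro conjI impI)
    fix g e s u v
    assume s: "region g e s" "u \<in> set_ttree s" "v \<in> set_ttree t" "v \<notin> set_ttree s"
    show "\<exists>z\<in>set_option g \<union> set_option e. (z, u) \<in> r \<and> (v, z) \<in> r" if "(v, u) \<in> r"
      using sep_down[OF s(1,2,4) that] by (metis UnI1 UnI2 option.set_intros)
    show "\<exists>z\<in>set_option g \<union> set_option e. (z, v) \<in> r \<and> (u, z) \<in> r" if "(u, v) \<in> r"
      using sep_up[OF s(1,2,4) that] by (metis UnI1 UnI2 option.set_intros)
  qed
  then show ?thesis using po distinct_tree set_t0 by unfold_locales auto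
qed

section \<open>Highest triangles and the twelve reversible sets\<close>

context tree_poset begin

definition top_reg :: "'a \<Rightarrow> 'a \<Rightarrow> 'a set \<Rightarrow> bool" where
  "top_reg a c S \<longleftrightarrow> (\<exists>g e L R. region g e (Node c L R Leaf) \<and> S = set_ttree (Node c L R Leaf) \<and> a \<preceq> c \<and>
     (\<forall>z. a \<preceq> z \<longrightarrow> z \<in> S))"

lemma ex_top_reg: "a \<in> X \<Longrightarrow> \<exists>c S. top_reg a c S"
  using ex_top[OF regions_refl, of a] le_X(2) set_t0 unfolding top_reg_def by metis

lemma node_antisym:
  assumes "region g e (Node c L R Leaf)" "region g' e' (Node d L' R' Leaf)"
    and "c \<in> set_ttree (Node d L' R' Leaf)" "d \<in> set_ttree (Node c L R Leaf)"
  shows "set_ttree (Node c L R Leaf) = set_ttree (Node d L' R' Leaf)" "c = d"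
proof -
  show eq: "set_ttree (Node c L R Leaf) = set_ttree (Node d L' R' Leaf)"
    using regions_set[OF node_in[OF assms(1,2,4)]] regions_set[OF node_in[OF assms(2,1,3)]] by blast
  have "d \<notin> set_ttree L'" "d \<notin> set_ttree R'" using regions_dist[OF assms(2) distinct_tree] by auto
  then have "(g, e, Node c L R Leaf) \<notin> regions g' (Some d) L'" "(g, e, Node c L R Leaf) \<notin> regions (Some d) e' R'"
    using regions_set assms(4) by blast+
  then show "c = d" using node_in[OF assms(2,1,3)] by auto
qed

lemma top_reg_unique:
  assumes "top_reg a c S" "top_reg a c' S'"
  shows "S = S'"
proof -
  obtain g e L R where 1: "region g e (Node c L R Leaf)" "S = set_ttree (Node c L R Leaf)" "a \<preceq> c" "\<forall>z. a \<preceq> z \<longrightarrow> z \<in> S"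
    using assms(1) by (auto simp: top_reg_def)
  obtain g' e' L' R' where 2: "region g' e' (Node c' L' R' Leaf)" "S' = set_ttree (Node c' L' R' Leaf)" "a \<preceq> c'"
    "\<forall>z. a \<preceq> z \<longrightarrow> z \<in> S'"
    using assms(2) unfolding top_reg_def by blast
  show ?thesis using node_antisym(1)[OF 1(1) 2(1)] 1 2 by blast
qed

text \<open>Order \<open>k\<close> takes the pairs for which the top apex \<open>T b\<close> comes
  before \<open>T a\<close>. If a \<le> b', then \<open>T b'\<close> lies in the triangle of
  \<open>T a\<close>, so \<open>T a\<close> comes no later than \<open>T b'\<close>, which comes
  before \<open>T a'\<close>. The number of \<open>T a\<close> strictly increases along alternating
  steps, and no cycle is possible.\<close>

lemma covered_outside: "covered X r 2 {(a, b). a \<in> X \<and> b \<in> X \<and> (\<exists>c S. top_reg a c S \<and> b \<notin> S)}"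
proof -
  obtain T S where T: "\<And>a. a \<in> X \<Longrightarrow> top_reg a (T a) (S a)"
    using ex_top_reg by metis
  define I where "I = (\<lambda>k. {(a, b). a \<in> X \<and> b \<in> X \<and> dfs_num k t0 (T b) < dfs_num k t0 (T a)})"
  show ?thesis
  proof (rule covered_2I[where I = I])
    fix k
    show "reversible X r (I k)"
    proof (rule reversibleI[OF finite_carrier po])
      show "I k \<subseteq> X \<times> X" by (auto simp: I_def)
      let ?R = "{((a, b), (a', b')). (a, b) \<in> I k \<and> (a', b') \<in> I k \<and> a \<preceq> b'}"
      have "dfs_num k t0 (T a) < dfs_num k t0 (T a')" if "((a, b), (a', b')) \<in> ?R" for a b a' b'
      proof -
        have X: "a \<in> X" "b' \<in> X" and lt: "dfs_num k t0 (T b') < dfs_num k t0 (T a')" and le: "a \<preceq> b'"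
          using that by (auto simp: I_def)
        obtain g e L R where a: "region g e (Node (T a) L R Leaf)" "\<forall>z. a \<preceq> z \<longrightarrow> z \<in> set_ttree (Node (T a) L R Leaf)"
          using T[OF X(1)] unfolding top_reg_def by blast
        have "b' \<preceq> T b'" using T[OF X(2)] by (auto simp: top_reg_def)
        then have "T b' \<in> set_ttree (Node (T a) L R Leaf)" using a(2) le le_trans by blast
        then have "T b' = T a \<or> dfs_num k t0 (T a) < dfs_num k t0 (T b')"
          using dfs_num_desc[OF distinct_tree a(1)] by auto
        then show ?thesis using lt by auto
      qed
      then have "?R \<subseteq> (measure (\<lambda>i. dfs_num k t0 (T (fst i))))" by auto
      then show "acyclic ?R" using wf_acyclic[OF wf_measure] acyclic_subset by blast
    qed
  next
    show "{(a, b). a \<in> X \<and> b \<in> X \<and> (\<exists>c S. top_reg a c S \<and> b \<notin> S)} \<subseteq> I True \<union> I False"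
    proof (clarify)
      fix a b c S' assume X: "a \<in> X" "b \<in> X" and S': "top_reg a c S'" "b \<notin> S'" and "(a, b) \<notin> I False"
      have b: "b \<notin> S a" using top_reg_unique[OF S'(1) T[OF X(1)]] S'(2) by simp
      obtain g e L R where a: "region g e (Node (T a) L R Leaf)" "S a = set_ttree (Node (T a) L R Leaf)"
        using T[OF X(1)] unfolding top_reg_def by blast
      obtain g' e' L' R' where bT: "region g' e' (Node (T b) L' R' Leaf)" "b \<preceq> T b"
        "\<forall>z. b \<preceq> z \<longrightarrow> z \<in> set_ttree (Node (T b) L' R' Leaf)"
        using T[OF X(2)] unfolding top_reg_def by blast
      have "b \<in> set_ttree (Node (T b) L' R' Leaf)" using bT(3) X le_refl by blast
      \<comment> \<open>If \<open>T b\<close> were in the top triangle of \<open>a\<close>, so would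
        be the whole triangle of \<open>T b\<close>, which contains \<open>b\<close>.\<close>
      then have "T b \<notin> S a" using regions_set[OF node_in[OF a(1) bT(1)]] b a(2) by blast
      moreover have "T b \<in> set_ttree t0" using bT(2) le_X set_t0 by blast
      ultimately have "dfs_num True t0 (T b) < dfs_num True t0 (T a) \<or> dfs_num False t0 (T b) < dfs_num False t0 (T a)"
        using dfs_num_incomparable[OF distinct_tree a(1)] a(2) by blast
      then show "(a, b) \<in> I True" using X \<open>(a, b) \<notin> I False\<close> by (auto simp: I_def)
    qed
  qed
qed

lemma inside_plus:
  assumes a: "top_reg a c S" and b: "b \<in> S" "(a, b) \<notin> r" and y: "(y, b) \<in> r" "y \<notin> S"
  shows "right_pair a b \<or> tree_poset.right_pair r (mirror t0) a b"
proof -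
  interpret m: tree_poset X r "mirror t0" using tree_poset_mirror tree_poset_axioms .
  obtain g e L R where c: "region g e (Node c L R Leaf)" "S = set_ttree (Node c L R Leaf)" "(a, c) \<in> r"
    "\<forall>z. (a, z) \<in> r \<longrightarrow> z \<in> S"
    using a unfolding top_reg_def by blast
  have "b \<in> set_ttree L \<or> b \<in> set_ttree R" using b c by auto
  then show ?thesis
  proof
    assume "b \<in> set_ttree R"
    then have "right_witness a b g e c L R" using c b y unfolding right_witness_def by blast
    then show ?thesis unfolding right_pair_def by blast
  next
    assume bL: "b \<in> set_ttree L"
    have "(e, g, Node c (mirror R) (mirror L) Leaf) \<in> regions None None (mirror t0)"
      unfolding regions_mirror[of None None] using c(1) by force
    moreover have "set_ttree (Node c (mirror R) (mirror L) Leaf) = S" using c(2) by auto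
    ultimately have "m.right_witness a b e g c (mirror R) (mirror L)"
      using c(3,4) b y bL unfolding m.right_witness_def by auto
    then show ?thesis unfolding m.right_pair_def by blast
  qed
qed

text \<open>The order and its dual contribute six sets each: two classes for the tree, two for its
  mirror image, and two depth-first orders. For a pair that escapes all of them, the top triangle of
  \<open>a\<close> and the dual one of \<open>b\<close> contain each other's apex; so these apexes
  coincide, and a \<le> c \<le> b.\<close>

theorem covered_incomparable: "covered X r 12 {(a, b). a \<in> X \<and> b \<in> X \<and> (a, b) \<notin> r}"
proof -
  interpret m: tree_poset X r "mirror t0" using tree_poset_mirror tree_poset_axioms .
  interpret c: tree_poset X "r\<inverse>" t0 using tree_poset_converse tree_poset_axioms .
  interpret cm: tree_poset X "r\<inverse>" "mirror t0" using tree_poset_mirror c.tree_poset_axioms .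
  let ?A = "{(a, b). right_pair a b} \<union> {(a, b). m.right_pair a b}"
  let ?B = "{(a, b). a \<in> X \<and> b \<in> X \<and> (\<exists>c S. top_reg a c S \<and> b \<notin> S)}"
  let ?C = "{(a, b). c.right_pair a b} \<union> {(a, b). cm.right_pair a b}"
  let ?D = "{(a, b). a \<in> X \<and> b \<in> X \<and> (\<exists>d S. c.top_reg a d S \<and> b \<notin> S)}"
  have AB: "covered X r (2 + 2 + 2) (?A \<union> ?B)"
    by (intro covered_Un covered_plus m.covered_plus covered_outside)
  have CD: "covered X (r\<inverse>) (2 + 2 + 2) (?C \<union> ?D)"
    by (intro covered_Un c.covered_plus cm.covered_plus c.covered_outside)
  have all: "(a, b) \<in> (?A \<union> ?B) \<union> (?C \<union> ?D)\<inverse>" if X: "a \<in> X" "b \<in> X" and nab: "(a, b) \<notin> r" for a b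
  proof (rule ccontr)
    assume neg: "\<not> ?thesis"
    obtain c S where c: "top_reg a c S" using ex_top_reg X by blast
    obtain d S' where d: "c.top_reg b d S'" using c.ex_top_reg X by blast
    have bS: "b \<in> S" using neg c X by blast
    have aS': "a \<in> S'" using neg d X by blast
    \<comment> \<open>Outside \<open>S\<close>, the element \<open>d\<close> would be the lower
      bound of \<open>b\<close> that \<open>inside_plus\<close> asks for.\<close>
    have dS: "d \<in> S"
      using inside_plus[OF c bS nab] neg d unfolding c.top_reg_def by blast
    have nba: "\<not> (b, a) \<in> r\<inverse>" using nab by simp
    have cS': "c \<in> S'"
      using c.inside_plus[OF d aS' nba] neg c unfolding top_reg_def by blast
    obtain g e L R where 1: "region g e (Node c L R Leaf)" "S = set_ttree (Node c L R Leaf)" "(a, c) \<in> r"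
      using c unfolding top_reg_def by blast
    obtain g' e' L' R' where 2: "region g' e' (Node d L' R' Leaf)" "S' = set_ttree (Node d L' R' Leaf)" "(d, b) \<in> r"
      using d unfolding c.top_reg_def by blast
    have "c = d" using node_antisym(2)[OF 1(1) 2(1)] 1(2) 2(2) cS' dS by blast
    then show False using 1(3) 2(3) nab le_trans by blast
  qed
  have "covered X r (2 + 2 + 2 + (2 + 2 + 2)) ((?A \<union> ?B) \<union> (?C \<union> ?D)\<inverse>)"
    by (rule covered_Un[OF AB covered_converse[OF CD]])
  then have "covered X r 12 ((?A \<union> ?B) \<union> (?C \<union> ?D)\<inverse>)" by simp
  then show ?thesis by (rule covered_mono) (use all in blast)
qed

end

section \<open>From elimination orders to oriented 2-trees\<close>

primrec apexes :: "'a option \<Rightarrow> 'a option \<Rightarrow> 'a ttree \<Rightarrow> ('a \<times> 'a option \<times> 'a option) set" where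
  "apexes g e Leaf = {}"
| "apexes g e (Node x L R N) = insert (x, g, e) (apexes g (Some x) L \<union> apexes (Some x) e R \<union> apexes g e N)"

text \<open>The positions of the leaves. Since the list of triangles on each edge ends in a leaf,
  every oriented edge of the 2-tree has a slot for one more triangle.\<close>

primrec slots :: "'a option \<Rightarrow> 'a option \<Rightarrow> 'a ttree \<Rightarrow> ('a option \<times> 'a option) set" where
  "slots g e Leaf = {(g, e)}"
| "slots g e (Node x L R N) = slots g (Some x) L \<union> slots (Some x) e R \<union> slots g e N"

lemma slots_refl [simp]: "(g, e) \<in> slots g e t" by (induction t arbitrary: g e) auto

lemma slots_node:
  "(v, g', e') \<in> apexes g e t \<Longrightarrow> (g', Some v) \<in> slots g e t \<and> (Some v, e') \<in> slots g e t"
  by (induction t arbitrary: g e) auto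

lemma node_ex: "v \<in> set_ttree t \<Longrightarrow> \<exists>g' e'. (v, g', e') \<in> apexes g e t"
proof (induction t arbitrary: g e)
  case (Node x L R N)
  then consider "v = x" | "v \<in> set_ttree L" | "v \<in> set_ttree R" | "v \<in> set_ttree N" by auto
  then show ?case
  proof cases
    case 2
    then show ?thesis using Node.IH(1)[of g "Some x"] by auto
  next
    case 3
    then show ?thesis using Node.IH(2)[of "Some x" e] by auto
  next
    case 4
    then show ?thesis using Node.IH(3)[of g e] by auto
  qed auto
qed simp

lemma insert_at_slot:
  assumes "(g', e') \<in> slots g e t" "x \<notin> set_ttree t" "distinct_tree t"
  shows "\<exists>t'. distinct_tree t' \<and> set_ttree t' = insert x (set_ttree t) \<and> apexes g e t' = insert (x, g', e') (apexes g e t)"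
  using assms
proof (induction t arbitrary: g e)
  case Leaf
  then show ?case by (intro exI[of _ "Node x Leaf Leaf Leaf"]) auto
next
  case (Node y L R N)
  consider "(g', e') \<in> slots g (Some y) L" | "(g', e') \<in> slots (Some y) e R" | "(g', e') \<in> slots g e N"
    using Node.prems by auto
  then show ?case
  proof cases
    case 1
    then obtain L' where "distinct_tree L'" "set_ttree L' = insert x (set_ttree L)"
      "apexes g (Some y) L' = insert (x, g', e') (apexes g (Some y) L)"
      using Node.IH(1) Node.prems(2,3) by (metis UnI1 UnI2 distinct_tree.simps(2) ttree.set_intros(2))
    then show ?thesis using Node.prems(2,3) by (intro exI[of _ "Node y L' R N"]) auto
  next
    case 2
    then obtain R' where "distinct_tree R'" "set_ttree R' = insert x (set_ttree R)"
      "apexes (Some y) e R' = insert (x, g', e') (apexes (Some y) e R)"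
      using Node.IH(2) Node.prems(2,3) by (metis UnI1 UnI2 distinct_tree.simps(2) ttree.set_intros(3))
    then show ?thesis using Node.prems(2,3) by (intro exI[of _ "Node y L R' N"]) auto
  next
    case 3
    then obtain N' where "distinct_tree N'" "set_ttree N' = insert x (set_ttree N)"
      "apexes g e N' = insert (x, g', e') (apexes g e N)"
      using Node.IH(3) Node.prems(2,3) by (metis UnI1 UnI2 distinct_tree.simps(2) ttree.set_intros(4))
    then show ?thesis using Node.prems(2,3) by (intro exI[of _ "Node y L R N'"]) auto
  qed
qed

text \<open>An edge of the 2-tree seen from its later endpoint: \<open>v\<close> was attached as
  apex to an edge with end \<open>u\<close>.\<close>

definition linked :: "'a ttree \<Rightarrow> 'a \<Rightarrow> 'a \<Rightarrow> bool" where
  "linked t u v \<longleftrightarrow> (\<exists>g e. (v, g, e) \<in> apexes None None t \<and> u \<in> set_option g \<union> set_option e)"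

lemma card_le_2_cases:
  assumes "finite D" "card D \<le> 2"
  obtains "D = {}" | v where "D = {v}" | u v where "D = {u, v}" "u \<noteq> v"
proof -
  consider "card D = 0" | "card D = 1" | "card D = 2" using assms(2) by linarith
  then show ?thesis
    using assms(1) that by cases (auto simp: card_1_singleton_iff card_2_iff)
qed

text \<open>The intersection graph of the sets \<open>S x\<close> has a perfect elimination order:
  by \<open>simplicial\<close>, every nonempty subfamily has a member whose neighbours all share one
  node with it. Inserting the vertices in the reverse order attaches each of them to at most two
  earlier ones, which are already joined.\<close>

lemma ex_tree:
  fixes S :: "'a \<Rightarrow> 'b set"
  assumes "finite X"
    and simplicial: "\<And>Y. Y \<subseteq> X \<Longrightarrow> Y \<noteq> {} \<Longrightarrow> \<exists>x\<in>Y. \<exists>w\<in>S x. \<forall>y\<in>Y. S x \<inter> S y \<noteq> {} \<longrightarrow> w \<in> S y"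
    and width: "\<And>x w. x \<in> X \<Longrightarrow> w \<in> S x \<Longrightarrow> card {y \<in> X. w \<in> S y} \<le> 3"
  shows "\<exists>t. distinct_tree t \<and> set_ttree t = X \<and> (\<forall>u\<in>X. \<forall>v\<in>X. u \<noteq> v \<longrightarrow> S u \<inter> S v \<noteq> {} \<longrightarrow> linked t u v \<or> linked t v u)"
proof -
  have "\<exists>t. distinct_tree t \<and> set_ttree t = Y \<and> (\<forall>u\<in>Y. \<forall>v\<in>Y. u \<noteq> v \<longrightarrow> S u \<inter> S v \<noteq> {} \<longrightarrow> linked t u v \<or> linked t v u)"
    if "finite Y" "Y \<subseteq> X" for Y
    using that
  proof (induction Y rule: finite_psubset_induct)
    case (psubset Y)
    show ?case
    proof (cases "Y = {}")
      case True
      then show ?thesis by (intro exI[of _ Leaf]) auto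
    next
      case False
      then obtain x w where x: "x \<in> Y" "w \<in> S x" "\<And>y. y \<in> Y \<Longrightarrow> S x \<inter> S y \<noteq> {} \<Longrightarrow> w \<in> S y"
        using simplicial[OF psubset.prems] by blast
      have Yx: "Y - {x} \<subset> Y" "Y - {x} \<subseteq> X" using x(1) psubset.prems by auto
      from psubset.IH[OF Yx] obtain t where "distinct_tree t \<and> set_ttree t = Y - {x} \<and> (\<forall>u\<in>Y - {x}. \<forall>v\<in>Y - {x}.
          u \<noteq> v \<longrightarrow> S u \<inter> S v \<noteq> {} \<longrightarrow> linked t u v \<or> linked t v u)" ..
      then have t: "distinct_tree t" "set_ttree t = Y - {x}"
        and t_linked: "\<And>u v. u \<in> Y - {x} \<Longrightarrow> v \<in> Y - {x} \<Longrightarrow> u \<noteq> v \<Longrightarrow> S u \<inter> S v \<noteq> {} \<Longrightarrow>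
          linked t u v \<or> linked t v u"
        by simp_all
      \<comment> \<open>\<open>D\<close> contains all neighbours of \<open>x\<close> in
        \<open>Y\<close>. Its members share \<open>w\<close>, so any two of them are already linked;
        as \<open>S x\<close> contains \<open>w\<close> too, the bound 3 leaves room for
        two.\<close>
      define D where "D = {y \<in> Y - {x}. w \<in> S y}"
      have fin: "finite {y \<in> X. w \<in> S y}" using assms(1) by auto
      have "card (insert x D) \<le> card {y \<in> X. w \<in> S y}"
        using x psubset.prems fin by (intro card_mono) (auto simp: D_def)
      also have "\<dots> \<le> 3" using width x psubset.prems by blast
      finally have "card D \<le> 2"
        using psubset.hyps by (subst (asm) card_insert_disjoint) (auto simp: D_def)
      moreover have "finite D" using psubset.hyps by (auto simp: D_def)
      ultimately consider "D = {}" | v where "D = {v}" | u v where "D = {u, v}" "u \<noteq> v"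
        using card_le_2_cases by blast
      then have "\<exists>g e. (g, e) \<in> slots None None t \<and> D \<subseteq> set_option g \<union> set_option e"
      proof cases
        case 1
        then show ?thesis using slots_refl by blast
      next
        case (2 v)
        then have "v \<in> set_ttree t" using t(2) by (auto simp: D_def)
        then obtain g e where "(v, g, e) \<in> apexes None None t" using node_ex[of v t None None] by blast
        then show ?thesis using slots_node[of v g e] 2 by (intro exI[of _ g] exI[of _ "Some v"]) auto
      next
        case (3 u v)
        have uv: "u \<in> D" "v \<in> D" "D = {v, u}" using 3 by auto
        \<comment> \<open>The later vertex \<open>q\<close> is the apex of a triangle that has
          \<open>p\<close> as an end of its base. So \<open>p\<close> and \<open>q\<close> span a
          side of this triangle, and sides have slots.\<close>
        have ex: "\<exists>g e. (g, e) \<in> slots None None t \<and> D \<subseteq> set_option g \<union> set_option e"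
          if "linked t p q" "D = {p, q}" for p q
        proof -
          obtain g e where ge: "(q, g, e) \<in> apexes None None t" "p \<in> set_option g \<union> set_option e"
            using \<open>linked t p q\<close> by (auto simp: linked_def)
          from ge(2) show ?thesis
          proof
            assume "p \<in> set_option g"
            then show ?thesis using slots_node[OF ge(1)] \<open>D = {p, q}\<close> by (intro exI[of _ g] exI[of _ "Some q"]) auto
          next
            assume "p \<in> set_option e"
            then show ?thesis using slots_node[OF ge(1)] \<open>D = {p, q}\<close> by (intro exI[of _ "Some q"] exI[of _ e]) auto
          qed
        qed
        have "linked t u v \<or> linked t v u" using t_linked[of u v] uv 3(2) unfolding D_def by blast
        then show ?thesis using ex[of u v] ex[of v u] 3(1) uv(3) by blast
      qed
      then obtain g e where ge: "(g, e) \<in> slots None None t" "D \<subseteq> set_option g \<union> set_option e" by blast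
      obtain t' where t': "distinct_tree t'" "set_ttree t' = insert x (set_ttree t)"
        "apexes None None t' = insert (x, g, e) (apexes None None t)"
        using insert_at_slot[OF ge(1) _ t(1), of x] t(2) by auto
      have mono: "linked t u v \<Longrightarrow> linked t' u v" for u v using t'(3) by (auto simp: linked_def)
      have new: "linked t' y x" if "y \<in> Y" "y \<noteq> x" "S x \<inter> S y \<noteq> {}" for y
      proof -
        have "y \<in> D" using x(3)[OF that(1,3)] that by (auto simp: D_def)
        then show ?thesis using ge(2) t'(3) by (auto simp: linked_def)
      qed
      have "linked t' u v \<or> linked t' v u" if "u \<in> Y" "v \<in> Y" "u \<noteq> v" "S u \<inter> S v \<noteq> {}" for u v
      proof (cases "u = x \<or> v = x")
        case True
        then show ?thesis
        proof
          assume "u = x"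
          then show ?thesis using new[of v] that by blast
        next
          assume "v = x"
          then show ?thesis using new[of u] that by blast
        qed
      next
        case False
        then show ?thesis using t_linked[of u v] mono that by blast
      qed
      moreover have "set_ttree t' = Y" using t'(2) t(2) x(1) by auto
      ultimately show ?thesis using t'(1) by blast
    qed
  qed
  then show ?thesis using assms(1) by blast
qed

section \<open>Covers, links and the ends of regions\<close>

lemma apexes_set:
  "(p, gp, ep) \<in> apexes g e t \<Longrightarrow> p \<in> set_ttree t"
  "(p, gp, ep) \<in> apexes g e t \<Longrightarrow> set_option gp \<union> set_option ep \<subseteq> set_ttree t \<union> set_option g \<union> set_option e"
proof -
  show "(p, gp, ep) \<in> apexes g e t \<Longrightarrow> p \<in> set_ttree t" by (induction t arbitrary: g e) (simp, fastforce)
  show "(p, gp, ep) \<in> apexes g e t \<Longrightarrow> set_option gp \<union> set_option ep \<subseteq> set_ttree t \<union> set_option g \<union> set_option e"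
  proof (induction t arbitrary: g e)
    case (Node x L R N)
    consider "(p, gp, ep) = (x, g, e)" | "(p, gp, ep) \<in> apexes g (Some x) L"
      | "(p, gp, ep) \<in> apexes (Some x) e R" | "(p, gp, ep) \<in> apexes g e N" using Node.prems by auto
    then show ?case
    proof cases
      case 1 then show ?thesis by auto
    next
      case 2 then show ?thesis using Node.IH(1)[OF 2] by auto
    next
      case 3 then show ?thesis using Node.IH(2)[OF 3] by auto
    next
      case 4 then show ?thesis using Node.IH(3)[OF 4] by auto
    qed
  qed simp
qed

lemma node_in_reg:
  assumes "distinct_tree t" "(g', e', t') \<in> regions g e t" "(p, gp, ep) \<in> apexes g e t" "p \<in> set_ttree t'"
  shows "set_option gp \<union> set_option ep \<subseteq> set_ttree t' \<union> set_option g' \<union> set_option e'"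
  using assms
proof (induction t arbitrary: g e)
  case (Node x L R N)
  have d: "distinct_tree L" "distinct_tree R" "distinct_tree N" using Node.prems(1) by auto
  have node: "(p, gp, ep) = (x, g, e) \<or> (p, gp, ep) \<in> apexes g (Some x) L \<or>
      (p, gp, ep) \<in> apexes (Some x) e R \<or> (p, gp, ep) \<in> apexes g e N" using Node.prems(3) by auto
  consider "(g', e', t') = (g, e, Node x L R N)" | "(g', e', t') = (g, e, Node x L R Leaf)"
    | "(g', e', t') \<in> regions g (Some x) L" | "(g', e', t') \<in> regions (Some x) e R" | "(g', e', t') \<in> regions g e N"
    using Node.prems(2) by auto
  then show ?case
  proof cases
    case 1
    then show ?thesis using apexes_set(2)[OF Node.prems(3)] by auto
  next
    case 2
    then have "p \<notin> set_ttree N" using Node.prems(1,4) by auto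
    then have n: "(p, gp, ep) \<in> apexes g e (Node x L R Leaf)" using node apexes_set(1)[of p gp ep g e N] by auto
    show ?thesis using apexes_set(2)[OF n] 2 by simp
  next
    case 3
    then have "p \<in> set_ttree L" using regions_set[OF 3] Node.prems(4) by blast
    then have "(p, gp, ep) \<in> apexes g (Some x) L"
      using node apexes_set(1)[of p gp ep g e N] apexes_set(1)[of p gp ep "Some x" e R] Node.prems(1) by auto
    then show ?thesis using Node.IH(1)[OF d(1) 3] Node.prems(4) by blast
  next
    case 4
    then have "p \<in> set_ttree R" using regions_set[OF 4] Node.prems(4) by blast
    then have "(p, gp, ep) \<in> apexes (Some x) e R"
      using node apexes_set(1)[of p gp ep g e N] apexes_set(1)[of p gp ep g "Some x" L] Node.prems(1) by auto
    then show ?thesis using Node.IH(2)[OF d(2) 4] Node.prems(4) by blast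
  next
    case 5
    then have "p \<in> set_ttree N" using regions_set[OF 5] Node.prems(4) by blast
    then have "(p, gp, ep) \<in> apexes g e N"
      using node apexes_set(1)[of p gp ep "Some x" e R] apexes_set(1)[of p gp ep g "Some x" L] Node.prems(1) by auto
    then show ?thesis using Node.IH(3)[OF d(3) 5] Node.prems(4) by blast
  qed
qed simp

text \<open>Edges ending at \<open>q\<close> arise only below the triangle with apex
  \<open>q\<close>. A region containing \<open>q\<close> contains that triangle, hence all triangles
  on such edges.\<close>

lemma node_end_in_reg:
  assumes "distinct_tree t" "(set_option g \<union> set_option e) \<inter> set_ttree t = {}" "(g', e', t') \<in> regions g e t"
    "(p, gp, ep) \<in> apexes g e t" "q \<in> set_option gp \<union> set_option ep" "q \<in> set_ttree t'"
  shows "p \<in> set_ttree t'"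
  using assms
proof (induction t arbitrary: g e)
  case (Node x L R N)
  have d: "distinct_tree L" "distinct_tree R" "distinct_tree N" using Node.prems(1) by auto
  have node: "(p, gp, ep) = (x, g, e) \<or> (p, gp, ep) \<in> apexes g (Some x) L \<or>
      (p, gp, ep) \<in> apexes (Some x) e R \<or> (p, gp, ep) \<in> apexes g e N" using Node.prems(4) by auto
  have q: "q \<notin> set_option g" "q \<notin> set_option e" using Node.prems(2,3,6) regions_set by blast+
  have nL: "(p, gp, ep) \<in> apexes g (Some x) L \<Longrightarrow> p \<in> set_ttree L \<and> (q \<in> set_ttree L \<or> q = x)"
    using apexes_set[of p gp ep g "Some x" L] Node.prems(5) q by auto
  have nR: "(p, gp, ep) \<in> apexes (Some x) e R \<Longrightarrow> p \<in> set_ttree R \<and> (q \<in> set_ttree R \<or> q = x)"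
    using apexes_set[of p gp ep "Some x" e R] Node.prems(5) q by auto
  have nN: "(p, gp, ep) \<in> apexes g e N \<Longrightarrow> p \<in> set_ttree N \<and> q \<in> set_ttree N"
    using apexes_set[of p gp ep g e N] Node.prems(5) q by auto
  have nx: "(p, gp, ep) \<noteq> (x, g, e)" using q Node.prems(5) by auto
  consider "(g', e', t') = (g, e, Node x L R N)" | "(g', e', t') = (g, e, Node x L R Leaf)"
    | "(g', e', t') \<in> regions g (Some x) L" | "(g', e', t') \<in> regions (Some x) e R" | "(g', e', t') \<in> regions g e N"
    using Node.prems(3) by auto
  then show ?case
  proof cases
    case 1
    then show ?thesis using apexes_set(1)[OF Node.prems(4)] by auto
  next
    case 2
    then have "q \<notin> set_ttree N" using Node.prems(1,6) by auto
    then show ?thesis using node nx nL nR nN 2 by auto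
  next
    case 3
    then have "q \<in> set_ttree L" using regions_set[OF 3] Node.prems(6) by blast
    then have "(p, gp, ep) \<in> apexes g (Some x) L" using node nx nR nN Node.prems(1) by auto
    moreover have "(set_option g \<union> set_option (Some x)) \<inter> set_ttree L = {}" using Node.prems(1,2) by auto
    ultimately show ?thesis using Node.IH(1)[OF d(1) _ 3] Node.prems(5,6) by blast
  next
    case 4
    then have "q \<in> set_ttree R" using regions_set[OF 4] Node.prems(6) by blast
    then have "(p, gp, ep) \<in> apexes (Some x) e R" using node nx nL nN Node.prems(1) by auto
    moreover have "(set_option (Some x) \<union> set_option e) \<inter> set_ttree R = {}" using Node.prems(1,2) by auto
    ultimately show ?thesis using Node.IH(2)[OF d(2) _ 4] Node.prems(5,6) by blast
  next
    case 5
    then have "q \<in> set_ttree N" using regions_set[OF 5] Node.prems(6) by blast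
    then have "(p, gp, ep) \<in> apexes g e N" using node nx nL nR Node.prems(1) by auto
    moreover have "(set_option g \<union> set_option e) \<inter> set_ttree N = {}" using Node.prems(2) by auto
    ultimately show ?thesis using Node.IH(3)[OF d(3) _ 5] Node.prems(5,6) by blast
  qed
qed simp

lemma linked_leaving:
  assumes "distinct_tree t" "(g, e, s) \<in> regions None None t" "u \<in> set_ttree s" "v \<notin> set_ttree s"
    and "linked t u v \<or> linked t v u"
  shows "v \<in> set_option g \<union> set_option e"
  using assms(5)
proof
  assume "linked t u v"
  then have False
    using node_end_in_reg[OF assms(1) _ assms(2)] assms(3,4) by (auto simp: linked_def)
  then show ?thesis ..
next
  assume "linked t v u"
  then show ?thesis
    using node_in_reg[OF assms(1,2)] assms(3,4) unfolding linked_def by blast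
qed

text \<open>Take \<open>p\<close> in \<open>A\<close> between \<open>u\<close> and \<open>v\<close>
  with the smallest interval up to \<open>v\<close>, hence maximal, and then \<open>q\<close>
  directly above \<open>p\<close> in this interval. By the choice of \<open>p\<close>,
  \<open>q\<close> is no longer in \<open>A\<close>.\<close>

lemma ex_crossing_cover:
  assumes "finite X" and po: "partial_order_on X r" and uv: "(u, v) \<in> r" "u \<in> A" "v \<notin> A"
  shows "\<exists>p q. p \<in> A \<and> q \<notin> A \<and> (u, p) \<in> r \<and> (p, q) \<in> r \<and> (q, v) \<in> r \<and> p \<noteq> q \<and>
    \<not> (\<exists>z. (p, z) \<in> r \<and> p \<noteq> z \<and> (z, q) \<in> r \<and> z \<noteq> q)"
proof -
  have r: "trans r" "antisym r" "r \<subseteq> X \<times> X" and refl: "\<And>x. x \<in> X \<Longrightarrow> (x, x) \<in> r"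
    using po by (auto simp: order_on_defs refl_on_def)
  have X: "u \<in> X" "v \<in> X" using uv(1) r(3) by auto
  have tr: "(x, y) \<in> r \<Longrightarrow> (y, z) \<in> r \<Longrightarrow> (x, z) \<in> r" for x y z using transD[OF r(1)] .
  have as: "(x, y) \<in> r \<Longrightarrow> (y, x) \<in> r \<Longrightarrow> x = y" for x y using antisymD[OF r(2)] .
  define I where "I = (\<lambda>x y. {z. (x, z) \<in> r \<and> (z, y) \<in> r})"
  have "I x y \<subseteq> X" for x y using r(3) by (auto simp: I_def)
  then have fin: "finite (I x y)" for x y using assms(1) finite_subset by blast
  have "u \<in> A \<and> u \<in> I u v" using uv refl[OF X(1)] by (simp add: I_def)
  from ex_has_least_nat[where P = "\<lambda>p. p \<in> A \<and> p \<in> I u v" and m = "\<lambda>p. card (I p v)", OF this]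
  obtain p where p: "p \<in> A" "p \<in> I u v"
    and min_p: "\<And>q. q \<in> A \<Longrightarrow> q \<in> I u v \<Longrightarrow> card (I p v) \<le> card (I q v)" by blast
  have "v \<in> I p v \<and> v \<noteq> p" using p uv(3) refl[OF X(2)] by (auto simp: I_def)
  from ex_has_least_nat[where P = "\<lambda>q. q \<in> I p v \<and> q \<noteq> p" and m = "\<lambda>q. card (I p q)", OF this]
  obtain q where q: "q \<in> I p v" "q \<noteq> p"
    and min_q: "\<And>z. z \<in> I p v \<Longrightarrow> z \<noteq> p \<Longrightarrow> card (I p q) \<le> card (I p z)" by blast
  have pr: "(u, p) \<in> r" "(p, q) \<in> r" "(q, v) \<in> r" using p(2) q(1) by (auto simp: I_def)
  have refl_pq: "(p, p) \<in> r" "(q, q) \<in> r" using pr(2) r(3) refl by auto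
  have "q \<notin> A"
  proof
    assume "q \<in> A"
    moreover have "q \<in> I u v" using tr[OF pr(1,2)] pr(3) by (simp add: I_def)
    ultimately have "card (I p v) \<le> card (I q v)" by (rule min_p)
    moreover have "I q v \<subset> I p v"
    proof
      show "I q v \<subseteq> I p v" using tr[OF pr(2)] by (auto simp: I_def)
      have "p \<in> I p v" using tr[OF pr(2,3)] refl_pq by (simp add: I_def)
      moreover have "p \<notin> I q v" using as[OF pr(2)] q(2) by (auto simp: I_def)
      ultimately show "I q v \<noteq> I p v" by blast
    qed
    ultimately show False using psubset_card_mono[OF fin] by (metis leD)
  qed
  moreover have "\<not> (\<exists>z. (p, z) \<in> r \<and> p \<noteq> z \<and> (z, q) \<in> r \<and> z \<noteq> q)"
  proof
    assume "\<exists>z. (p, z) \<in> r \<and> p \<noteq> z \<and> (z, q) \<in> r \<and> z \<noteq> q"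
    then obtain z where z: "(p, z) \<in> r" "p \<noteq> z" "(z, q) \<in> r" "z \<noteq> q" by blast
    have "z \<in> I p v" using z(1) tr[OF z(3) pr(3)] by (simp add: I_def)
    then have "card (I p q) \<le> card (I p z)" using z(2) by (intro min_q) auto
    moreover have "I p z \<subset> I p q"
    proof
      show "I p z \<subseteq> I p q" using tr[OF _ z(3)] by (auto simp: I_def)
      have "q \<in> I p q" using pr(2) refl_pq by (simp add: I_def)
      moreover have "q \<notin> I p z" using as[OF z(3)] z(4) by (auto simp: I_def)
      ultimately show "I p z \<noteq> I p q" by blast
    qed
    ultimately show False using psubset_card_mono[OF fin] by (metis leD)
  qed
  ultimately show ?thesis using p(1) pr q(2) by blast
qed

lemma separatingI:
  assumes "finite X" "partial_order_on X r" and t: "distinct_tree t" "set_ttree t = X"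
    and cov: "\<And>p q. (p, q) \<in> r \<Longrightarrow> p \<noteq> q \<Longrightarrow> \<not> (\<exists>z. (p, z) \<in> r \<and> p \<noteq> z \<and> (z, q) \<in> r \<and> z \<noteq> q) \<Longrightarrow>
      linked t p q \<or> linked t q p"
  shows "separating r t"
  unfolding separating_def
proof (clarify, intro conjI impI)
  fix g e s u v
  assume s: "(g, e, s) \<in> regions None None t" "u \<in> set_ttree s" "v \<notin> set_ttree s"
  have r: "(x, x) \<in> r" "trans r" if "x \<in> X" for x
    using assms(2) that by (auto simp: order_on_defs refl_on_def)
  have X: "x \<in> X" "y \<in> X" if "(x, y) \<in> r" for x y using assms(2) that by (auto simp: order_on_defs)
  show "\<exists>z\<in>set_option g \<union> set_option e. (u, z) \<in> r \<and> (z, v) \<in> r" if uv: "(u, v) \<in> r"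
  proof -
    obtain p q where pq: "p \<in> set_ttree s" "q \<notin> set_ttree s" "(u, p) \<in> r" "(p, q) \<in> r" "(q, v) \<in> r"
      "linked t p q \<or> linked t q p"
      using ex_crossing_cover[OF assms(1,2) uv s(2,3)] cov by blast
    have "q \<in> set_option g \<union> set_option e" by (rule linked_leaving[OF t(1) s(1) pq(1,2,6)])
    moreover have "(u, q) \<in> r" using pq(3,4) r(2)[OF X(1)[OF uv]] by (auto dest: transD)
    ultimately show ?thesis using pq(5) by blast
  qed
  show "\<exists>z\<in>set_option g \<union> set_option e. (v, z) \<in> r \<and> (z, u) \<in> r" if vu: "(v, u) \<in> r"
  proof -
    \<comment> \<open>A chain that enters the region leaves its complement, so the same lemma serves
      for the other direction.\<close>
    obtain p q where pq: "p \<notin> set_ttree s" "q \<in> set_ttree s" "(v, p) \<in> r" "(p, q) \<in> r" "(q, u) \<in> r"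
      "linked t q p \<or> linked t p q"
      using ex_crossing_cover[OF assms(1,2) vu, of "- set_ttree s"] s(2,3) cov by blast
    have "p \<in> set_option g \<union> set_option e" by (rule linked_leaving[OF t(1) s(1) pq(2,1,6)])
    moreover have "(p, u) \<in> r" using pq(4,5) r(2)[OF X(1)[OF vu]] by (auto dest: transD)
    ultimately show ?thesis using pq(3) by blast
  qed
qed

section \<open>Subtrees of a tree\<close>

lemma pcas_snoc: "pcas u (p @ [(a, b)]) w \<longleftrightarrow> pcas u p a \<and> w = b"
  by (induction p arbitrary: u) auto

lemma pawalk_verts_snoc: "pcas u p a \<Longrightarrow> pawalk_verts u (p @ [(a, b)]) = pawalk_verts u p @ [b]"
  by (induction p arbitrary: u) auto

definition path_in :: "'b pair_pre_digraph \<Rightarrow> 'b set \<Rightarrow> 'b \<Rightarrow> ('b \<times> 'b) list \<Rightarrow> 'b \<Rightarrow> bool" where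
  "path_in T W u p v \<longleftrightarrow> pcas u p v \<and> set p \<subseteq> parcs T \<and> distinct (pawalk_verts u p) \<and>
     set (pawalk_verts u p) \<subseteq> W"

lemma path_in_snoc:
  assumes "path_in T W u p a" "(a, b) \<in> parcs T" "b \<notin> W"
  shows "path_in T (insert b W) u (p @ [(a, b)]) b"
  using assms by (auto simp: path_in_def pcas_snoc pawalk_verts_snoc)

lemma crossing_arc:
  assumes "connected (with_proj G)" "u \<in> pverts G" "v \<in> pverts G" "u \<in> A" "v \<notin> A"
  shows "\<exists>a b. a \<in> A \<and> b \<notin> A \<and> a \<in> pverts G \<and> b \<in> pverts G \<and> ((a, b) \<in> parcs G \<or> (b, a) \<in> parcs G)"
proof -
  let ?M = "mk_symmetric (with_proj G)"
  have "(u, v) \<in> rtrancl_on (pverts G) (parcs ?M)"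
    using assms(1-3) unfolding connected_def strongly_connected_def reachable_def
    by (auto simp: mk_symmetric_def)
  then have "v \<in> A \<or> ?thesis"
  proof (induction rule: rtrancl_on_induct)
    case base
    then show ?case using assms(4) by simp
  next
    case (step y z)
    then have "(y, z) \<in> parcs G \<or> (z, y) \<in> parcs G" by (auto simp: mk_symmetric_def)
    then show ?case using step by blast
  qed
  then show ?thesis using assms(5) by blast
qed

text \<open>Number the nodes while a connected set grows by adjacent nodes. A new node with two
  earlier neighbours would close a cycle with a path between them inside the set. The unique earlier
  neighbour acts as the parent.\<close>

lemma tree_order:
  assumes "undirected_tree T"
  obtains idx :: "'b \<Rightarrow> nat" where "inj_on idx (pverts T)"
    "\<And>u u' v. (u, v) \<in> parcs T \<Longrightarrow> (u', v) \<in> parcs T \<Longrightarrow> idx u < idx v \<Longrightarrow> idx u' < idx v \<Longrightarrow> u = u'"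
proof -
  interpret T: pair_graph T using assms by (simp add: undirected_tree_def)
  have conn: "connected (with_proj T)" using assms by (simp add: undirected_tree_def)
  have no_cycle: "\<not> T.cycle p" if "3 \<le> length p" for p
    using assms that by (auto simp: undirected_tree_def)
  let ?V = "pverts T"
  have fin: "finite ?V" using T.pair_finite_verts .
  \<comment> \<open>All numbers stay below \<open>card W\<close>, so \<open>card W\<close> is free
    for the next node and larger than the numbers used before.\<close>
  define Q where "Q = (\<lambda>W (idx :: 'b \<Rightarrow> nat). W \<subseteq> ?V \<and> W \<noteq> {} \<and> (\<forall>u\<in>W. \<forall>v\<in>W. \<exists>p. path_in T W u p v) \<and>
    inj_on idx W \<and> (\<forall>u\<in>W. idx u < card W) \<and>
    (\<forall>u\<in>W. \<forall>u'\<in>W. \<forall>v\<in>W. (u, v) \<in> parcs T \<longrightarrow> (u', v) \<in> parcs T \<longrightarrow> idx u < idx v \<longrightarrow> idx u' < idx v \<longrightarrow> u = u'))"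
  have grow: "\<exists>W' idx'. Q W' idx' \<and> card W' = Suc (card W)" if Q: "Q W idx" and neq: "W \<noteq> ?V" for W idx
  proof -
    have W: "W \<subseteq> ?V" "W \<noteq> {}" "finite W" using Q fin finite_subset by (auto simp: Q_def)
    obtain w0 v0 where "w0 \<in> W" "v0 \<in> ?V" "v0 \<notin> W" using W neq by blast
    then obtain u0 v where v: "u0 \<in> W" "v \<notin> W" "v \<in> ?V" "(u0, v) \<in> parcs T \<or> (v, u0) \<in> parcs T"
      using crossing_arc[OF conn, of w0 v0 W] W by blast
    then have arcs: "(u0, v) \<in> parcs T" "(v, u0) \<in> parcs T" using T.arcs_symmetric by blast+
    let ?W = "insert v W" and ?idx = "idx(v := card W)"
    have P: "\<exists>p. path_in T W u p w" if "u \<in> W" "w \<in> W" for u w using Q that by (auto simp: Q_def)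
    have "\<exists>p. path_in T ?W u p w" if uw: "u \<in> ?W" "w \<in> ?W" for u w
    proof -
      consider "u = v" "w = v" | "u \<in> W" "w \<in> W" | "u = v" "w \<in> W" | "u \<in> W" "w = v" using uw by blast
      then show ?thesis
      proof cases
        case 1
        then show ?thesis by (intro exI[of _ "[]"]) (auto simp: path_in_def)
      next
        case 2
        then obtain p where "path_in T W u p w" using P by blast
        then show ?thesis by (intro exI[of _ p]) (auto simp: path_in_def)
      next
        case 3
        then obtain p where "path_in T W u0 p w" using P v(1) by blast
        then show ?thesis using 3 arcs v(2) by (intro exI[of _ "(v, u0) # p"]) (auto simp: path_in_def)
      next
        case 4
        then obtain p where "path_in T W u p u0" using P v(1) by blast
        from path_in_snoc[OF this arcs(1) v(2)] show ?thesis using 4 by blast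
      qed
    qed
    moreover have "inj_on ?idx ?W"
    proof -
      have "card W \<notin> idx ` W" using Q by (force simp: Q_def)
      moreover have "inj_on ?idx W" using Q inj_on_fun_updI[OF _ \<open>card W \<notin> idx ` W\<close>] by (simp add: Q_def)
      moreover have "?idx ` W = idx ` W" using v(2) by (intro image_cong) auto
      moreover have "W - {v} = W" using v(2) by blast
      ultimately show ?thesis by (simp only: inj_on_insert fun_upd_same simp_thms)
    qed
    moreover have "\<forall>u\<in>?W. ?idx u < card ?W" 
    proof
      fix u assume "u \<in> ?W"
      moreover have "card ?W = Suc (card W)" using W(3) v(2) by simp
      moreover have "idx w < card W" if "w \<in> W" for w using Q that by (simp add: Q_def)
      ultimately show "?idx u < card ?W" by (cases "u = v") (simp_all add: less_SucI)
    qed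
    moreover have "u = u'" if u: "u \<in> ?W" "u' \<in> ?W" "w \<in> ?W" and a: "(u, w) \<in> parcs T" "(u', w) \<in> parcs T"
      and i: "?idx u < ?idx w" "?idx u' < ?idx w" for u u' w
    proof (cases "w = v")
      case False
      then have wW: "w \<in> W" "?idx w = idx w" using u by auto
      then have "idx w < card W" using Q by (auto simp: Q_def)
      then have "u \<noteq> v" "u' \<noteq> v" using i wW by auto
      then show ?thesis using Q u a i wW by (auto simp: Q_def)
    next
      case True
      then have uW: "u \<in> W" "u' \<in> W" using u i by auto
      show ?thesis
      proof (rule ccontr)
        assume "u \<noteq> u'"
        obtain p where p: "path_in T W u p u'" using P uW by blast
        then have "p \<noteq> []" using \<open>u \<noteq> u'\<close> by (auto simp: path_in_def)
        \<comment> \<open>As \<open>p\<close> is nonempty, this closed walk has at least three arcs,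
          the length from which \<open>undirected_tree\<close> forbids cycles.\<close>
        let ?c = "(v, u) # p @ [(u', v)]"
        have "(v, u) \<in> parcs T" using a(1) True T.arcs_symmetric by blast
        moreover have "pcas v ?c v"
          using p by (simp only: path_in_def pcas_snoc pcas.simps fst_conv snd_conv simp_thms)
        moreover have "set ?c \<subseteq> parcs T"
          using \<open>(v, u) \<in> parcs T\<close> p a(2) True by (simp add: path_in_def)
        ultimately have "T.awalk v ?c v" using v(3) unfolding T.awalk_def by blast
        moreover have "distinct (tl (pawalk_verts v ?c))"
          using p v(2) by (auto simp: path_in_def pawalk_verts_snoc)
        ultimately have "T.cycle ?c" unfolding T.cycle_def by blast
        moreover have "3 \<le> length ?c" using \<open>p \<noteq> []\<close> by (cases p) auto
        ultimately show False using no_cycle by blast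
      qed
    qed
    ultimately have "Q ?W ?idx" using W v(3) unfolding Q_def by blast
    moreover have "card ?W = Suc (card W)" using W(3) v(2) by simp
    ultimately show ?thesis by blast
  qed
  have "?V \<noteq> {}" using conn by (auto simp: connected_def strongly_connected_def mk_symmetric_def)
  then obtain v0 where v0: "v0 \<in> ?V" by blast
  have base: "Q {v0} (\<lambda>_. 0)"
    using v0 T.pair_no_loops unfolding Q_def
    by (auto simp: path_in_def intro!: exI[of _ "[]"])
  have "\<exists>W idx. Q W idx \<and> card W = Suc k" if "k < card ?V" for k
    using that
  proof (induction k)
    case 0
    then show ?case using base by (intro exI[of _ "{v0}"] exI[of _ "\<lambda>_. 0"]) simp
  next
    case (Suc k)
    then obtain W idx where "Q W idx" "card W = Suc k" by auto
    moreover have "W \<noteq> ?V" using \<open>card W = Suc k\<close> Suc.prems by auto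
    ultimately show ?case using grow by metis
  qed
  from this[of "card ?V - 1"] obtain W idx where W: "Q W idx" "card W = card ?V"
    using \<open>?V \<noteq> {}\<close> fin by (metis One_nat_def Suc_pred card_gt_0_iff diff_less zero_less_one)
  then have "W = ?V" using card_subset_eq[OF fin _ W(2)] by (simp add: Q_def)
  then show thesis using W(1) that[of idx] T.wellformed' unfolding Q_def by blast
qed

text \<open>Let \<open>D\<close> be the descendants of \<open>u\<close>, reached by arcs with
  increasing numbers; \<open>m\<close> is not among them. By connectedness some arc of
  \<open>S\<close> leaves \<open>D\<close>. It must go to a parent, and every member of
  \<open>D\<close> except \<open>u\<close> has its parent in \<open>D\<close>; so it goes from
  \<open>u\<close> to the parent of \<open>u\<close>.\<close>

lemma subtree_parent:
  assumes T: "undirected_tree T" and S: "subtree S T" and inj: "inj_on idx (pverts T)"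
    and uniq: "\<forall>u u' v. (u, v) \<in> parcs T \<longrightarrow> (u', v) \<in> parcs T \<longrightarrow> idx u < (idx v :: nat) \<longrightarrow> idx u' < idx v \<longrightarrow> u = u'"
    and m: "m \<in> pverts S" "u \<in> pverts S" "idx m < idx u"
  obtains p where "p \<in> pverts S" "(p, u) \<in> parcs T" "idx p < idx u"
proof -
  interpret T: pair_graph T using T by (simp add: undirected_tree_def)
  have conn: "connected (with_proj S)" and sub: "pverts S \<subseteq> pverts T" "parcs S \<subseteq> parcs T"
    using S by (auto simp: subtree_def undirected_tree_def subgraph_def)
  define R where "R = {(w, w') \<in> parcs T. idx w < idx w'}"
  define D where "D = {w. (u, w) \<in> R\<^sup>*}"
  have "idx u \<le> idx w" if "w \<in> D" for w
  proof -
    have "(u, w) \<in> R\<^sup>*" using that by (simp add: D_def)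
    then show ?thesis by induction (auto simp: R_def)
  qed
  then have "m \<notin> D" using m(3) by fastforce
  moreover have "u \<in> D" by (simp add: D_def)
  ultimately obtain w w' where w: "w \<in> D" "w' \<notin> D" "w \<in> pverts S" "w' \<in> pverts S"
    "(w, w') \<in> parcs S \<or> (w', w) \<in> parcs S"
    using crossing_arc[OF conn m(2,1)] by blast
  then have a: "(w, w') \<in> parcs T" "(w', w) \<in> parcs T" using sub T.arcs_symmetric by blast+
  have "\<not> idx w < idx w'"
  proof
    assume "idx w < idx w'"
    then have "(w, w') \<in> R" using a by (simp add: R_def)
    then show False using w(1,2) by (auto simp: D_def intro: rtrancl_into_rtrancl)
  qed
  moreover have "idx w \<noteq> idx w'" using inj w sub by (metis inj_on_def subsetD)
  ultimately have lt: "idx w' < idx w" by simp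
  show thesis
  proof (cases "w = u")
    case True
    then show ?thesis using that[of w'] w a lt by blast
  next
    case False
    have "(u, w) \<in> R\<^sup>*" using w(1) by (simp add: D_def)
    then obtain v where v: "(u, v) \<in> R\<^sup>*" "(v, w) \<in> R" using False by (metis rtranclE)
    then have "v = w'" using uniq a lt by (auto simp: R_def)
    then show ?thesis using v w(2) by (simp add: D_def)
  qed
qed

text \<open>Root each subtree at its node \<open>m x\<close> with the least number. Two subtrees
  that meet in a node share its parent too, until the climb reaches the later of the two roots, so
  this root lies in both. A subtree with the latest root of all is therefore simplicial, with
  \<open>m x\<close> as the common node.\<close>

lemma subtrees_simplicial:
  fixes T :: "'b pair_pre_digraph"
  assumes T: "undirected_tree T" and S: "\<And>x. x \<in> Y \<Longrightarrow> subtree (S x) T" and Y: "finite Y" "Y \<noteq> {}"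
  shows "\<exists>x\<in>Y. \<exists>w\<in>pverts (S x). \<forall>y\<in>Y. pverts (S x) \<inter> pverts (S y) \<noteq> {} \<longrightarrow> w \<in> pverts (S y)"
proof -
  obtain idx :: "'b \<Rightarrow> nat" where inj: "inj_on idx (pverts T)"
    and uniq: "\<forall>u u' v. (u, v) \<in> parcs T \<longrightarrow> (u', v) \<in> parcs T \<longrightarrow> idx u < idx v \<longrightarrow> idx u' < idx v \<longrightarrow> u = u'"
    using tree_order[OF T] by metis
  have sub: "pverts (S x) \<subseteq> pverts T" "pverts (S x) \<noteq> {}" if "x \<in> Y" for x
    using S[OF that] by (auto simp: subtree_def undirected_tree_def subgraph_def
        connected_def strongly_connected_def mk_symmetric_def)
  have "\<exists>m. m \<in> pverts (S x) \<and> (\<forall>w\<in>pverts (S x). idx m \<le> idx w)" if "x \<in> Y" for x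
    using ex_has_least_nat[of "\<lambda>w. w \<in> pverts (S x)" _ idx] sub(2)[OF that] by blast
  then obtain m where m: "\<And>x. x \<in> Y \<Longrightarrow> m x \<in> pverts (S x)"
    and min: "\<And>x w. x \<in> Y \<Longrightarrow> w \<in> pverts (S x) \<Longrightarrow> idx (m x) \<le> idx w" by metis
  have meet: "m x \<in> pverts (S y)"
    if xY: "x \<in> Y" and yY: "y \<in> Y" and le: "idx (m y) \<le> idx (m x)"
      and "w \<in> pverts (S x)" "w \<in> pverts (S y)" for x y w
    using that(4,5)
  proof (induction "idx w" arbitrary: w rule: less_induct)
    case less
    show ?case
    proof (cases "w = m x")
      case True
      then show ?thesis using less.prems by simp
    next
      case False
      have "idx w \<noteq> idx (m x)"
        using False inj m[OF xY] less.prems(1) sub(1)[OF xY] by (metis inj_on_def subsetD)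
      then have lt: "idx (m x) < idx w" using min[OF xY less.prems(1)] by simp
      then have lt': "idx (m y) < idx w" using le by simp
      obtain p where p: "p \<in> pverts (S x)" "(p, w) \<in> parcs T" "idx p < idx w"
        using subtree_parent[OF T S[OF xY] inj uniq m[OF xY] less.prems(1) lt] by blast
      obtain q where q: "q \<in> pverts (S y)" "(q, w) \<in> parcs T" "idx q < idx w"
        using subtree_parent[OF T S[OF yY] inj uniq m[OF yY] less.prems(2) lt'] by blast
      have "p = q" using uniq p q by blast
      then show ?thesis using less.hyps[OF p(3) p(1)] q(1) by blast
    qed
  qed
  obtain x where x: "x \<in> Y" "\<And>y. y \<in> Y \<Longrightarrow> idx (m y) \<le> idx (m x)"
    using Max_in[of "(\<lambda>x. idx (m x)) ` Y"] Max_ge[of "(\<lambda>x. idx (m x)) ` Y"] Y by fastforce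
  have "\<forall>y\<in>Y. pverts (S x) \<inter> pverts (S y) \<noteq> {} \<longrightarrow> m x \<in> pverts (S y)"
    using meet[OF x(1) _ x(2)] by blast
  then show ?thesis using x(1) m by blast
qed

section \<open>Conclusion\<close>

text \<open>With this decomposition \<open>LEAST\<close> in \<open>treewidth\<close> ranges over a
  nonempty set for finite graphs, so the minimum is attained.\<close>

lemma trivial_tree_decomposition:
  "\<exists>(T :: nat pair_pre_digraph) S. tree_decomposition G T S"
proof -
  let ?T = "\<lparr>pverts = {0 :: nat}, parcs = {}\<rparr>"
  interpret T: pair_graph ?T by unfold_locales (auto simp: symmetric_def sym_def)
  have "connected (with_proj ?T)"
    by (auto simp: connected_def strongly_connected_def mk_symmetric_def reachable_def)
  moreover have "\<not> T.cycle p" for p by (auto simp: T.cycle_def T.awalk_def)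
  ultimately have tree: "undirected_tree ?T" unfolding undirected_tree_def using T.pair_graph by blast
  have "subgraph (with_proj ?T) (with_proj ?T)"
    by (auto simp: subgraph_def compatible_def T.wf_digraph_axioms)
  then have "subtree ?T ?T" using tree by (simp add: subtree_def)
  then have "tree_decomposition G ?T (\<lambda>_. ?T)" using tree by (auto simp: tree_decomposition_def)
  then show ?thesis by blast
qed

lemma treewidth_decomposition:
  assumes "finite (pverts G)" "treewidth G \<le> k"
  obtains T :: "nat pair_pre_digraph" and S where "tree_decomposition G T S"
    "\<And>u. u \<in> pverts T \<Longrightarrow> card {x \<in> pverts G. u \<in> pverts (S x)} \<le> k + 1"
proof -
  let ?P = "\<lambda>t. \<exists>(T :: nat pair_pre_digraph) S. tree_decomposition G T S \<and>
     (\<forall>u\<in>pverts T. card {x \<in> pverts G. u \<in> pverts (S x)} \<le> t + 1)"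
  obtain T :: "nat pair_pre_digraph" and S where "tree_decomposition G T S"
    using trivial_tree_decomposition by blast
  moreover have "card {x \<in> pverts G. u \<in> pverts (S x)} \<le> card (pverts G) + 1" for u
    using card_mono[OF assms(1), of "{x \<in> pverts G. u \<in> pverts (S x)}"] by auto
  ultimately have "?P (card (pverts G))" by blast
  then have "?P (treewidth G)" unfolding treewidth_def by (rule LeastI)
  then obtain T :: "nat pair_pre_digraph" and S where TS: "tree_decomposition G T S"
    "\<And>u. u \<in> pverts T \<Longrightarrow> card {x \<in> pverts G. u \<in> pverts (S x)} \<le> treewidth G + 1" by blast
  have "card {x \<in> pverts G. u \<in> pverts (S x)} \<le> k + 1" if "u \<in> pverts T" for u
    using TS(2)[OF that] assms(2) by linarith
  then show thesis using that TS(1) by blast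
qed

lemma ex_tree_poset:
  assumes fin: "finite X" and po: "partial_order_on X r"
    and tw: "treewidth (cover_graph X r) \<le> 2"
  shows "\<exists>t. tree_poset X r t"
proof -
  have X: "pverts (cover_graph X r) = X" by (simp add: cover_graph_def)
  obtain T :: "nat pair_pre_digraph" and S where T: "tree_decomposition (cover_graph X r) T S"
    and width: "\<And>u. u \<in> pverts T \<Longrightarrow> card {x \<in> X. u \<in> pverts (S x)} \<le> 3"
    using treewidth_decomposition[of "cover_graph X r" 2] fin tw by (auto simp: X)
  have tree: "undirected_tree T" and sub: "\<And>x. x \<in> X \<Longrightarrow> subtree (S x) T"
    and meet: "\<And>x y. (x, y) \<in> parcs (cover_graph X r) \<Longrightarrow> pverts (S x) \<inter> pverts (S y) \<noteq> {}"
    using T by (auto simp: tree_decomposition_def X)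
  have simplicial: "\<exists>x\<in>Y. \<exists>w\<in>pverts (S x). \<forall>y\<in>Y. pverts (S x) \<inter> pverts (S y) \<noteq> {} \<longrightarrow> w \<in> pverts (S y)"
    if "Y \<subseteq> X" "Y \<noteq> {}" for Y
    using subtrees_simplicial[OF tree _ finite_subset[OF that(1) fin] that(2), of S] sub that(1) by blast
  have card3: "card {y \<in> X. w \<in> pverts (S y)} \<le> 3" if "x \<in> X" "w \<in> pverts (S x)" for x w
    using width sub[OF that(1)] that(2) by (auto simp: subtree_def subgraph_def)
  have "\<exists>t. distinct_tree t \<and> set_ttree t = X \<and> (\<forall>u\<in>X. \<forall>v\<in>X. u \<noteq> v \<longrightarrow>
      pverts (S u) \<inter> pverts (S v) \<noteq> {} \<longrightarrow> linked t u v \<or> linked t v u)"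
    by (rule ex_tree[OF fin]) (erule (1) simplicial, erule (1) card3)
  then obtain t where t: "distinct_tree t" "set_ttree t = X"
    and linked: "\<And>u v. u \<in> X \<Longrightarrow> v \<in> X \<Longrightarrow> u \<noteq> v \<Longrightarrow> pverts (S u) \<inter> pverts (S v) \<noteq> {} \<Longrightarrow>
      linked t u v \<or> linked t v u"
    by blast
  have "separating r t"
  proof (rule separatingI[OF fin po t])
    fix p q
    assume pq: "(p, q) \<in> r" "p \<noteq> q" "\<not> (\<exists>z. (p, z) \<in> r \<and> p \<noteq> z \<and> (z, q) \<in> r \<and> z \<noteq> q)"
    then have pqX: "p \<in> X" "q \<in> X" using po by (auto simp: order_on_defs)
    have "covers r q p" using pq unfolding covers_def by blast
    then have "(p, q) \<in> parcs (cover_graph X r)" using pqX by (simp add: cover_graph_def)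
    then show "linked t p q \<or> linked t q p" using linked[OF pqX pq(2)] meet by blast
  qed
  then have "tree_poset X r t" using po t by unfold_locales
  then show ?thesis by blast
qed

lemma poset_dim_le:
  assumes po: "partial_order_on X r" and n: "0 < n"
    and cov: "covered X r n {(x, y). x \<in> X \<and> y \<in> X \<and> (x, y) \<notin> r}"
  shows "poset_dim X r \<le> n"
proof -
  obtain I where I: "\<And>k. k < n \<Longrightarrow> reversible X r (I k)"
    and all: "{(x, y). x \<in> X \<and> y \<in> X \<and> (x, y) \<notin> r} \<subseteq> (\<Union>k<n. I k)"
    using cov by (auto simp: covered_def)
  then have "\<forall>k. \<exists>L. k < n \<longrightarrow> linear_order_on X L \<and> r \<subseteq> L \<and> (\<forall>(x, y) \<in> I k. (y, x) \<in> L)"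
    unfolding reversible_def by blast
  then obtain L where L: "\<And>k. k < n \<Longrightarrow> linear_order_on X (L k) \<and> r \<subseteq> L k \<and> (\<forall>(x, y) \<in> I k. (y, x) \<in> L k)"
    by metis
  \<comment> \<open>The extensions in \<open>poset_dim\<close> are numbered from 1, the sets in
    \<open>covered\<close> from 0.\<close>
  define M where "M = (\<lambda>i. L (i - 1))"
  have M: "linear_extension X r (M i)" if "i \<in> {1..n}" for i
  proof -
    have "i - 1 < n" using that by auto
    from L[OF this] show ?thesis by (simp add: M_def linear_extension_def)
  qed
  have "(x, y) \<in> r \<longleftrightarrow> (\<forall>i\<in>{1..n}. (x, y) \<in> M i)" if xy: "x \<in> X" "y \<in> X" for x y
  proof
    assume "(x, y) \<in> r"
    then show "\<forall>i\<in>{1..n}. (x, y) \<in> M i" using M unfolding linear_extension_def by blast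
  next
    assume M_all: "\<forall>i\<in>{1..n}. (x, y) \<in> M i"
    show "(x, y) \<in> r"
    proof (rule ccontr)
      assume nr: "(x, y) \<notin> r"
      then obtain k where k: "k < n" "(x, y) \<in> I k" using all xy by blast
      then have "Suc k \<in> {1..n}" by simp
      then have "(x, y) \<in> L k" using M_all by (force simp: M_def)
      moreover have "(y, x) \<in> L k" "antisym (L k)" using L[OF k(1)] k(2) by (auto simp: order_on_defs)
      ultimately have "x = y" by (simp add: antisymD)
      then show False using nr xy po by (auto simp: order_on_defs refl_on_def)
    qed
  qed
  then show ?thesis unfolding poset_dim_def
    using M n by (intro Least_le conjI exI[of _ M]) auto
qed

theorem theorem1:
  fixes X :: "'a set" and r :: "'a rel"
  assumes "finite X" and "partial_order_on X r"
    and "treewidth (cover_graph X r) \<le> 2"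
  shows "poset_dim X r \<le> 1276"
proof -
  obtain t where "tree_poset X r t" using ex_tree_poset[OF assms] by blast
  then interpret tree_poset X r t .
  have "poset_dim X r \<le> 12" using poset_dim_le[OF assms(2) _ covered_incomparable] by simp
  then show ?thesis by simp
qed

end
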